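(* Consider TR-SQP-STORM (described in the context). Suppose the regularity assumption in the context holds and, in addition, for all $k\ge0$: (i) there exists $M>0$ such that $\|\bar g_k-g_k\|\le M$; (ii) there exists $\kappa_B>0$ such that $1/\kappa_B\le\|\bar H_k\|\le\kappa_B$ ($M,\kappa_B$ constants independent of $k$). Then there exist a (potentially stochastic) iteration threshold $\bar K<\infty$ and a deterministic constant $\hat\mu$ such that $\bar\mu_k=\bar\mu_{\bar K}\le\hat\mu$ for all $k\ge\bar K$.
   Context: **Problem and notation.** $\min_{x\in\mathbb R^d} f(x)=\mathbb E[F(x;\xi)]$ subject to $c(x)=0$, where $c=(c^1,\dots,c^m):\mathbb R^d\to\mathbb R^m$ is deterministic. $\|\cdot\|$ is the Euclidean norm (vectors) or operator norm (matrices). $G(x)=\nabla c(x)\in\mathbb R^{m\times d}$ is the Jacobian. Subscript $k$ denotes evaluation at $x_k$: $f_k$, $g_k=\nabla f(x_k)$, $\nabla^2f_k$, $c_k$, $G_k$, $\nabla^2c^i_k$. $Z_k\in\mathbb R^{d\times(d-m)}$ has orthonormal columns spanning $\ker G_k$. $\nabla_x^2\mathcal L_k=\nabla^2f_k+\sum_{i=1}^m\lambda_k^i\nabla^2c_k^i$ with $\lambda_k=-[G_kG_k^T]^{-1}G_kg_k$. **Algorithm TR-SQP-STORM.** Parameters: $\alpha\in\{0,1\}$ ($\alpha=0$: aim at first-order stationarity; $\alpha=1$: second-order); $p_h,p_g,p_f,\eta\in(0,1)$; $\kappa_{fcd}\in(0,1]$; $r,\Delta_{\max},\kappa_h,\kappa_g>0$;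 $0<\kappa_f\le\kappa_{fcd}\eta^3/(16\max\{1,\Delta_{\max}\})$; $\rho,\gamma>1$; initial $x_0$, $\Delta_0\in(0,\Delta_{\max})$, $\bar\epsilon_0,\bar\mu_0>0$. Iteration $k$, given $(x_k,\Delta_k,\bar\epsilon_k,\bar\mu_k)$: (1) Obtain a random estimate $\bar g_k$ of $g_k$; set $\bar\lambda_k=-[G_kG_k^T]^{-1}G_k\bar g_k$, $\bar\nabla_x\mathcal L_k=\bar g_k+G_k^T\bar\lambda_k$, $\bar\nabla\mathcal L_k=(\bar\nabla_x\mathcal L_k,c_k)$. If $\alpha=0$, take any matrix $\bar H_k$ approximating $\nabla_x^2\mathcal L_k$ and set $\bar\tau_k^+=0$. If $\alpha=1$, obtain a random estimate $\bar\nabla^2f_k$ of $\nabla^2f_k$, set $\bar H_k=\bar\nabla^2f_k+\sum_i\bar\lambda_k^i\nabla^2c_k^i$, let $\bar\tau_k$ be the smallest eigenvalue of $Z_k^T\bar H_kZ_k$ and $\bar\tau_k^+=|\min\{\bar\tau_k,0\}|$. (2) If $\max\{\|\bar\nabla\mathcal L_k\|/\max\{1,\|\bar H_k\|\},\,\bar\tau_k^+\}\ge\eta\Delta_k$ fails, the iteration is *unsuccessful*: $x_{k+1}=x_k$, $\Delta_{k+1}=\Delta_k/\gamma$, $\bar\epsilon_{k+1}=\bar\epsilon_k/\gamma$, $\bar\mu_{k+1}=\bar\mu_k$, and the iteration ends. Otherwise compute a trial step $\Delta x_k=w_k+Z_ku_k$, $w_k=\bar\gamma_kv_k$, $v_k=-G_k^T[G_kG_k^T]^{-1}c_k$,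 $\bar\gamma_k=\min\{\breve\Delta_k/\|v_k\|,1\}$ (its value is immaterial if $v_k=0$). Put $c_k^{RS}=c_k/\|G_k\|$, $\bar\nabla_x\mathcal L_k^{RS}=\bar\nabla_x\mathcal L_k/\|\bar H_k\|$, $\bar\nabla\mathcal L_k^{RS}=(\bar\nabla_x\mathcal L_k^{RS},c_k^{RS})$, $\bar\tau_k^{RS+}=\bar\tau_k^+/\|\bar H_k\|$, and $m(u)=\frac12(Z_ku)^T\bar H_kZ_ku+(\bar g_k+\bar H_kw_k)^TZ_ku$. If $\|\bar\nabla\mathcal L_k\|\min\{\Delta_k,\|\bar\nabla\mathcal L_k\|/\|\bar H_k\|\}\ge\bar\tau_k^+\Delta_k(\Delta_k+\|c_k\|)$, take a *gradient step*: $\breve\Delta_k=\Delta_k\|c_k^{RS}\|/\|\bar\nabla\mathcal L_k^{RS}\|$, $\tilde\Delta_k=\Delta_k\|\bar\nabla_x\mathcal L_k^{RS}\|/\|\bar\nabla\mathcal L_k^{RS}\|$, and $u_k$ is any vector with $\|u_k\|\le\tilde\Delta_k$ and $m(u_k)-m(0)\le-\frac{\kappa_{fcd}}2\|q_k\|\min\{\tilde\Delta_k,\|q_k\|/\|Z_k^T\bar H_kZ_k\|\}$, $q_k=Z_k^T(\bar g_k+\bar H_kw_k)$. Otherwise take an *eigen step*: $\breve\Delta_k=\Delta_k\|c_k^{RS}\|/\|(c_k^{RS},\bar\tau_k^{RS+})\|$, $\tilde\Delta_k=\Delta_k\bar\tau_k^{RS+}/\|(c_k^{RS},\bar\tau_k^{RS+})\|$,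 and $u_k$ is any vector with $(\bar g_k+\bar H_kw_k)^TZ_ku_k\le0$, $\|u_k\|\le\tilde\Delta_k$, $(Z_ku_k)^T\bar H_k(Z_ku_k)\le-\kappa_{fcd}\bar\tau_k^+\tilde\Delta_k^2$. (3) Let $\mathrm{Pred}_k=\bar g_k^T\Delta x_k+\frac12\Delta x_k^T\bar H_k\Delta x_k+\bar\mu_k(\|c_k+G_k\Delta x_k\|-\|c_k\|)$; replace $\bar\mu_k\leftarrow\rho\bar\mu_k$ until $\mathrm{Pred}_k\le-\frac{\kappa_{fcd}}2\max\{\|\bar\nabla\mathcal L_k\|\min\{\Delta_k,\|\bar\nabla\mathcal L_k\|/\|\bar H_k\|\},\,\bar\tau_k^+\Delta_k(\Delta_k+\|c_k\|)\}$. Then $\bar\mu_k$ denotes the value after this update, and $\bar\mu_{k+1}$ is initialized as $\bar\mu_k$. Set $x_{s_k}=x_k+\Delta x_k$, obtain random estimates $\bar f_k,\bar f_{s_k}$ of $f_k,f_{s_k}=f(x_{s_k})$, and let $\mathrm{Ared}_k=\bar f_{s_k}-\bar f_k+\bar\mu_k(\|c(x_{s_k})\|-\|c_k\|)$. (4) If $\mathrm{Ared}_k/\mathrm{Pred}_k\ge\eta$, the iteration is *successful*: $x_{k+1}=x_{s_k}$, $\Delta_{k+1}=\min\{\gamma\Delta_k,\Delta_{\max}\}$, and $\bar\epsilon_{k+1}=\gamma\bar\epsilon_k$ if $-\mathrm{Pred}_k\ge\bar\epsilon_k$, $\bar\epsilon_{k+1}=\bar\epsilon_k/\gamma$ otherwise.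 If $\mathrm{Ared}_k/\mathrm{Pred}_k<\eta$, $\alpha=1$ and $\|c_k\|\le r$, set $d_k=-G_k^T[G_kG_k^T]^{-1}\{c(x_k+\Delta x_k)-c_k-G_k\Delta x_k\}$ (second-order correction step), reset $x_{s_k}=x_k+\Delta x_k+d_k$, re-estimate $\bar f_{s_k}$, recompute $\mathrm{Ared}_k$; if now $\mathrm{Ared}_k/\mathrm{Pred}_k\ge\eta$, the iteration is successful with the updates just described. In all remaining cases it is *unsuccessful*: $x_{k+1}=x_k$, $\Delta_{k+1}=\Delta_k/\gamma$, $\bar\epsilon_{k+1}=\bar\epsilon_k/\gamma$. (The estimates are also required to satisfy certain accuracy conditions with fixed probability: with $\mathcal F_{k-1}$ the randomness before iteration $k$ and $\mathcal F_{k-0.5}$ additionally containing $\bar g_k,\bar\nabla^2f_k$: $P(\|\bar\nabla^2f_k-\nabla^2f_k\|\le\kappa_h\Delta_k\mid\mathcal F_{k-1})\ge1-p_h$ if $\alpha=1$; $P(\|\bar g_k-g_k\|\le\kappa_g\Delta_k^{\alpha+1}\mid\mathcal F_{k-1})\ge1-p_g$; $P(\max(|\bar f_k-f_k|,|\bar f_{s_k}-f_{s_k}|)\le\kappa_f\Delta_k^{\alpha+2}\mid\mathcal F_{k-0.5})\ge1-p_f$; $\max\{\mathbb E[|\bar f_k-f_k|^2\mid\mathcal F_{k-0.5}],\mathbb E[|\bar f_{s_k}-f_{s_k}|^2\mid\mathcal F_{k-0.5}]\}\le\bar\epsilon_k^2$.) **Regularity assumption.** There is an open convex set $\Omega\subseteq\mathbb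 R^d$ containing all iterates and trial points on which: $f$ is twice continuously differentiable and bounded below by $f_{\inf}$; $\nabla f,\nabla^2f$ are Lipschitz with constants $L_{\nabla f},L_{\nabla^2f}$; $c$ is twice continuously differentiable; $G$ is Lipschitz with constant $L_G$; each $\nabla^2c^i$ is Lipschitz with constant $L_{\nabla^2c}$. There are constants $\kappa_c,\kappa_{\nabla f},\kappa_{1,G},\kappa_{2,G}>0$ with $\|c_k\|\le\kappa_c$, $\|g_k\|\le\kappa_{\nabla f}$, $\kappa_{1,G}I\preceq G_kG_k^T\preceq\kappa_{2,G}I$ for all $k\ge0$. If $\alpha=0$, moreover $\|\bar H_k\|$ is bounded above by a constant at least $1$. *)

theory Defs
  imports "HOL-Probability.Probability"
begin

section \<open>Linear algebra and calculus\<close>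

text \<open>The library norm on \<open>real^'n^'m\<close> is the Frobenius norm; matrix norms below are operator norms.\<close>

definition opnorm :: "real^'n^'m \<Rightarrow> real" where
  "opnorm A = onorm ((*v) A)"

definition loewner_le :: "real^'n^'n \<Rightarrow> real^'n^'n \<Rightarrow> bool" where
  "loewner_le A B \<longleftrightarrow> (\<forall>y. y \<bullet> (A *v y) \<le> y \<bullet> (B *v y))"

definition eigenvalue_of :: "real^'n^'n \<Rightarrow> real \<Rightarrow> bool" where
  "eigenvalue_of A l \<longleftrightarrow> (\<exists>v. v \<noteq> 0 \<and> A *v v = l *\<^sub>R v)"

definition smallest_eigenvalue :: "real^'n^'n \<Rightarrow> real" where
  "smallest_eigenvalue A = (LEAST l. eigenvalue_of A l)"

definition grad :: "(real^'d \<Rightarrow> real) \<Rightarrow> real^'d \<Rightarrow> real^'d" where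
  "grad f x = (\<chi> i. frechet_derivative f (at x) (axis i 1))"

definition hess :: "(real^'d \<Rightarrow> real) \<Rightarrow> real^'d \<Rightarrow> real^'d^'d" where
  "hess f x = jacobian (grad f) (at x)"

abbreviation Jac :: "(real^'d \<Rightarrow> real^'m) \<Rightarrow> real^'d \<Rightarrow> real^'d^'m" where
  "Jac c x \<equiv> jacobian c (at x)"

text \<open>Twice continuous differentiability; only used for open \<open>S\<close>.\<close>

definition C2_on :: "(real^'d) set \<Rightarrow> (real^'d \<Rightarrow> real) \<Rightarrow> bool" where
  "C2_on S f \<longleftrightarrow> f differentiable_on S \<and> grad f differentiable_on S \<and> continuous_on S (hess f)"

definition op_lipschitz_on :: "real \<Rightarrow> (real^'d) set \<Rightarrow> (real^'d \<Rightarrow> real^'n^'k) \<Rightarrow> bool" where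
  "op_lipschitz_on L S A \<longleftrightarrow> (\<forall>x\<in>S. \<forall>y\<in>S. opnorm (A x - A y) \<le> L * norm (x - y))"

text \<open>\<open>f x = E[F(x; \<xi>)]\<close>, where \<open>X\<close> is the law of \<open>\<xi>\<close>.\<close>

definition expected_objective ::
    "'s measure \<Rightarrow> (real^'d \<Rightarrow> 's \<Rightarrow> real) \<Rightarrow> (real^'d \<Rightarrow> real) \<Rightarrow> bool" where
  "expected_objective X F f \<longleftrightarrow>
     prob_space X \<and> (\<forall>x. integrable X (F x) \<and> f x = (\<integral>s. F x s \<partial>X))"


section \<open>The algorithm TR-SQP-STORM\<close>

record parameters =
  par_\<alpha> :: nat
  par_p_h :: real
  par_p_g :: real
  par_p_f :: real
  par_\<eta> :: real
  par_\<kappa>_fcd :: real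
  par_r :: real
  par_\<Delta>_max :: real
  par_\<kappa>_h :: real
  par_\<kappa>_g :: real
  par_\<kappa>_f :: real
  par_\<rho> :: real
  par_\<gamma> :: real

definition valid_parameters :: "parameters \<Rightarrow> bool" where
  "valid_parameters p \<longleftrightarrow>
     par_\<alpha> p \<in> {0, 1} \<and>
     par_p_h p \<in> {0<..<1} \<and> par_p_g p \<in> {0<..<1} \<and> par_p_f p \<in> {0<..<1} \<and>
     par_\<eta> p \<in> {0<..<1} \<and> par_\<kappa>_fcd p \<in> {0<..1} \<and>
     par_r p > 0 \<and> par_\<Delta>_max p > 0 \<and> par_\<kappa>_h p > 0 \<and> par_\<kappa>_g p > 0 \<and>
     0 < par_\<kappa>_f p \<and>
     par_\<kappa>_f p \<le> par_\<kappa>_fcd p * par_\<eta> p ^ 3 / (16 * max 1 (par_\<Delta>_max p)) \<and>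
     par_\<rho> p > 1 \<and> par_\<gamma> p > 1"

text \<open>
  Everything that is realized in one iteration. The first four fields are the state
  \<open>(x\<^sub>k, \<Delta>\<^sub>k, \<epsilon>\<^sub>k, \<mu>\<^sub>k)\<close> at the start of the iteration, so \<open>it_\<mu>\<close> is the merit parameter before
  its update in this iteration. The other fields are the estimates and choices:
  \<open>it_g\<close> and \<open>it_hess\<close> estimate the gradient and Hessian of the objective, \<open>it_H\<close> is the model
  Hessian, \<open>it_Z\<close> the null-space basis, \<open>it_u\<close> the tangential coordinates, and
  \<open>it_f\<close>, \<open>it_fs\<close>, \<open>it_fsoc\<close> estimate the objective at the iterate, at the trial point, and at the
  trial point with second-order correction. A field the algorithm does not compute in an
  iteration is unconstrained. The index type \<open>'p\<close> has \<open>d - m\<close> elements.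
\<close>

record ('d::finite, 'p::finite) iteration =
  it_x :: "real^'d"
  it_\<Delta> :: real
  it_\<epsilon> :: real
  it_\<mu> :: real
  it_g :: "real^'d"
  it_hess :: "real^'d^'d"
  it_H :: "real^'d^'d"
  it_Z :: "real^'p^'d"
  it_u :: "real^'p"
  it_f :: real
  it_fs :: real
  it_fsoc :: real

text \<open>
  In the definitions below \<open>c\<close> is the constraint function and \<open>S\<close> the iteration record.
  The library norm of a pair is \<open>norm (a, b) = sqrt ((norm a)\<^sup>2 + (norm b)\<^sup>2)\<close>, the Euclidean norm of
  the stacked vector.
\<close>

definition lam_bar :: "(real^'d \<Rightarrow> real^'m) \<Rightarrow> ('d::finite, 'p::finite) iteration \<Rightarrow> real^'m" where
  "lam_bar c S = (let G = Jac c (it_x S)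
     in - (matrix_inv (G ** transpose G) *v (G *v it_g S)))"

definition gradL_bar :: "(real^'d \<Rightarrow> real^'m) \<Rightarrow> ('d::finite, 'p::finite) iteration \<Rightarrow> real^'d" where
  "gradL_bar c S = it_g S + transpose (Jac c (it_x S)) *v lam_bar c S"

definition kkt_bar :: "(real^'d \<Rightarrow> real^'m) \<Rightarrow> ('d::finite, 'p::finite) iteration \<Rightarrow> real" where
  "kkt_bar c S = norm (gradL_bar c S, c (it_x S))"

definition reduced_hess :: "('d::finite, 'p::finite) iteration \<Rightarrow> real^'p^'p" where
  "reduced_hess S = transpose (it_Z S) ** it_H S ** it_Z S"

definition tau_plus :: "parameters \<Rightarrow> ('d::finite, 'p::finite) iteration \<Rightarrow> real" where
  "tau_plus p S = (if par_\<alpha> p = 0 then 0 else \<bar>min (smallest_eigenvalue (reduced_hess S)) 0\<bar>)"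

definition computes_step :: "parameters \<Rightarrow> (real^'d \<Rightarrow> real^'m) \<Rightarrow> ('d::finite, 'p::finite) iteration \<Rightarrow> bool" where
  "computes_step p c S \<longleftrightarrow>
     max (kkt_bar c S / max 1 (opnorm (it_H S))) (tau_plus p S) \<ge> par_\<eta> p * it_\<Delta> S"

definition grad_decrease :: "(real^'d \<Rightarrow> real^'m) \<Rightarrow> ('d::finite, 'p::finite) iteration \<Rightarrow> real" where
  "grad_decrease c S = kkt_bar c S * min (it_\<Delta> S) (kkt_bar c S / opnorm (it_H S))"

definition eigen_decrease :: "parameters \<Rightarrow> (real^'d \<Rightarrow> real^'m) \<Rightarrow> ('d::finite, 'p::finite) iteration \<Rightarrow> real" where
  "eigen_decrease p c S = tau_plus p S * it_\<Delta> S * (it_\<Delta> S + norm (c (it_x S)))"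

definition gradient_step :: "parameters \<Rightarrow> (real^'d \<Rightarrow> real^'m) \<Rightarrow> ('d::finite, 'p::finite) iteration \<Rightarrow> bool" where
  "gradient_step p c S \<longleftrightarrow> grad_decrease c S \<ge> eigen_decrease p c S"

definition c_RS :: "(real^'d \<Rightarrow> real^'m) \<Rightarrow> ('d::finite, 'p::finite) iteration \<Rightarrow> real^'m" where
  "c_RS c S = c (it_x S) /\<^sub>R opnorm (Jac c (it_x S))"

definition gradL_RS :: "(real^'d \<Rightarrow> real^'m) \<Rightarrow> ('d::finite, 'p::finite) iteration \<Rightarrow> real^'d" where
  "gradL_RS c S = gradL_bar c S /\<^sub>R opnorm (it_H S)"

definition tau_RS :: "parameters \<Rightarrow> ('d::finite, 'p::finite) iteration \<Rightarrow> real" where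
  "tau_RS p S = tau_plus p S / opnorm (it_H S)"

definition normal_radius :: "parameters \<Rightarrow> (real^'d \<Rightarrow> real^'m) \<Rightarrow> ('d::finite, 'p::finite) iteration \<Rightarrow> real" where
  "normal_radius p c S =
     (if gradient_step p c S
      then it_\<Delta> S * norm (c_RS c S) / norm (gradL_RS c S, c_RS c S)
      else it_\<Delta> S * norm (c_RS c S) / norm (c_RS c S, tau_RS p S))"

definition tangential_radius :: "parameters \<Rightarrow> (real^'d \<Rightarrow> real^'m) \<Rightarrow> ('d::finite, 'p::finite) iteration \<Rightarrow> real" where
  "tangential_radius p c S =
     (if gradient_step p c S
      then it_\<Delta> S * norm (gradL_RS c S) / norm (gradL_RS c S, c_RS c S)
      else it_\<Delta> S * tau_RS p S / norm (c_RS c S, tau_RS p S))"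

definition normal_dir :: "(real^'d \<Rightarrow> real^'m) \<Rightarrow> ('d::finite, 'p::finite) iteration \<Rightarrow> real^'d" where
  "normal_dir c S = (let G = Jac c (it_x S)
     in - (transpose G *v (matrix_inv (G ** transpose G) *v c (it_x S))))"

text \<open>For \<open>normal_dir c S = 0\<close> the quotient below is \<open>0\<close>; the scaling factor is then immaterial.\<close>

definition normal_step :: "parameters \<Rightarrow> (real^'d \<Rightarrow> real^'m) \<Rightarrow> ('d::finite, 'p::finite) iteration \<Rightarrow> real^'d" where
  "normal_step p c S = min (normal_radius p c S / norm (normal_dir c S)) 1 *\<^sub>R normal_dir c S"

definition trial_step :: "parameters \<Rightarrow> (real^'d \<Rightarrow> real^'m) \<Rightarrow> ('d::finite, 'p::finite) iteration \<Rightarrow> real^'d" where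
  "trial_step p c S = normal_step p c S + it_Z S *v it_u S"

definition shifted_grad :: "parameters \<Rightarrow> (real^'d \<Rightarrow> real^'m) \<Rightarrow> ('d::finite, 'p::finite) iteration \<Rightarrow> real^'d" where
  "shifted_grad p c S = it_g S + it_H S *v normal_step p c S"

definition tangential_model ::
    "parameters \<Rightarrow> (real^'d \<Rightarrow> real^'m) \<Rightarrow> ('d::finite, 'p::finite) iteration \<Rightarrow> real^'p \<Rightarrow> real" where
  "tangential_model p c S u =
     1/2 * ((it_Z S *v u) \<bullet> (it_H S *v (it_Z S *v u))) + shifted_grad p c S \<bullet> (it_Z S *v u)"

text \<open>
  \<open>min D (a / b)\<close> with \<open>a / 0\<close> read as \<open>+\<infinity>\<close>. It is needed for the Cauchy decrease because the reduced
  Hessian may vanish although the model Hessian does not.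
\<close>

definition min_quot :: "real \<Rightarrow> real \<Rightarrow> real \<Rightarrow> real" where
  "min_quot D a b = (if b = 0 then D else min D (a / b))"

definition valid_tangential :: "parameters \<Rightarrow> (real^'d \<Rightarrow> real^'m) \<Rightarrow> ('d::finite, 'p::finite) iteration \<Rightarrow> bool" where
  "valid_tangential p c S \<longleftrightarrow>
     norm (it_u S) \<le> tangential_radius p c S \<and>
     (if gradient_step p c S
      then (let q = transpose (it_Z S) *v shifted_grad p c S in
              tangential_model p c S (it_u S) - tangential_model p c S 0
                \<le> - (par_\<kappa>_fcd p / 2 * norm q
                      * min_quot (tangential_radius p c S) (norm q) (opnorm (reduced_hess S))))
      else shifted_grad p c S \<bullet> (it_Z S *v it_u S) \<le> 0 \<and>
           (it_Z S *v it_u S) \<bullet> (it_H S *v (it_Z S *v it_u S))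
             \<le> - (par_\<kappa>_fcd p * tau_plus p S * (tangential_radius p c S)\<^sup>2))"

definition Pred_at :: "parameters \<Rightarrow> (real^'d \<Rightarrow> real^'m) \<Rightarrow> ('d::finite, 'p::finite) iteration \<Rightarrow> real \<Rightarrow> real" where
  "Pred_at p c S \<mu> = (let x = it_x S; s = trial_step p c S in
     it_g S \<bullet> s + 1/2 * (s \<bullet> (it_H S *v s)) + \<mu> * (norm (c x + Jac c x *v s) - norm (c x)))"

text \<open>
  The merit parameter after its update in this iteration: it is multiplied by \<open>\<rho>\<close> until the
  predicted reduction is large enough. That the loop terminates is not assumed.
\<close>

definition mu_updated :: "parameters \<Rightarrow> (real^'d \<Rightarrow> real^'m) \<Rightarrow> ('d::finite, 'p::finite) iteration \<Rightarrow> real" where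
  "mu_updated p c S =
     (if computes_step p c S
      then par_\<rho> p ^ (LEAST j. Pred_at p c S (par_\<rho> p ^ j * it_\<mu> S)
                         \<le> - (par_\<kappa>_fcd p / 2 * max (grad_decrease c S) (eigen_decrease p c S)))
             * it_\<mu> S
      else it_\<mu> S)"

definition Pred :: "parameters \<Rightarrow> (real^'d \<Rightarrow> real^'m) \<Rightarrow> ('d::finite, 'p::finite) iteration \<Rightarrow> real" where
  "Pred p c S = Pred_at p c S (mu_updated p c S)"

text \<open>\<open>xs\<close> is a trial point and \<open>fs\<close> the objective estimate there.\<close>

definition Ared_at ::
    "parameters \<Rightarrow> (real^'d \<Rightarrow> real^'m) \<Rightarrow> ('d::finite, 'p::finite) iteration \<Rightarrow> real^'d \<Rightarrow> real \<Rightarrow> real" where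
  "Ared_at p c S xs fs = fs - it_f S + mu_updated p c S * (norm (c xs) - norm (c (it_x S)))"

definition first_trial :: "parameters \<Rightarrow> (real^'d \<Rightarrow> real^'m) \<Rightarrow> ('d::finite, 'p::finite) iteration \<Rightarrow> real^'d" where
  "first_trial p c S = it_x S + trial_step p c S"

definition soc_step :: "parameters \<Rightarrow> (real^'d \<Rightarrow> real^'m) \<Rightarrow> ('d::finite, 'p::finite) iteration \<Rightarrow> real^'d" where
  "soc_step p c S = (let x = it_x S; G = Jac c x; s = trial_step p c S
     in - (transpose G *v (matrix_inv (G ** transpose G) *v (c (x + s) - c x - G *v s))))"

definition uses_soc :: "parameters \<Rightarrow> (real^'d \<Rightarrow> real^'m) \<Rightarrow> ('d::finite, 'p::finite) iteration \<Rightarrow> bool" where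
  "uses_soc p c S \<longleftrightarrow> computes_step p c S \<and>
     Ared_at p c S (first_trial p c S) (it_fs S) / Pred p c S < par_\<eta> p \<and>
     par_\<alpha> p = 1 \<and> norm (c (it_x S)) \<le> par_r p"

definition final_trial :: "parameters \<Rightarrow> (real^'d \<Rightarrow> real^'m) \<Rightarrow> ('d::finite, 'p::finite) iteration \<Rightarrow> real^'d" where
  "final_trial p c S =
     (if uses_soc p c S then first_trial p c S + soc_step p c S else first_trial p c S)"

definition final_estimate :: "parameters \<Rightarrow> (real^'d \<Rightarrow> real^'m) \<Rightarrow> ('d::finite, 'p::finite) iteration \<Rightarrow> real" where
  "final_estimate p c S = (if uses_soc p c S then it_fsoc S else it_fs S)"

definition successful :: "parameters \<Rightarrow> (real^'d \<Rightarrow> real^'m) \<Rightarrow> ('d::finite, 'p::finite) iteration \<Rightarrow> bool" where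
  "successful p c S \<longleftrightarrow> computes_step p c S \<and>
     Ared_at p c S (final_trial p c S) (final_estimate p c S) / Pred p c S \<ge> par_\<eta> p"

text \<open>
  For \<open>\<alpha> = 0\<close> the model Hessian is an arbitrary matrix. The first two conjuncts say that the
  columns of \<open>it_Z S\<close> are orthonormal and span the kernel of the constraint Jacobian.
\<close>

definition valid_iteration :: "parameters \<Rightarrow> (real^'d \<Rightarrow> real^'m) \<Rightarrow> ('d::finite, 'p::finite) iteration \<Rightarrow> bool" where
  "valid_iteration p c S \<longleftrightarrow>
     transpose (it_Z S) ** it_Z S = mat 1 \<and>
     span (columns (it_Z S)) = {y. Jac c (it_x S) *v y = 0} \<and>
     (par_\<alpha> p = 1 \<longrightarrow>
        it_H S = it_hess S + (\<Sum>i\<in>UNIV. lam_bar c S $ i *\<^sub>R hess (\<lambda>x. c x $ i) (it_x S))) \<and>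
     (computes_step p c S \<longrightarrow> valid_tangential p c S)"

definition valid_transition ::
    "parameters \<Rightarrow> (real^'d \<Rightarrow> real^'m) \<Rightarrow> ('d::finite, 'p::finite) iteration \<Rightarrow> ('d::finite, 'p::finite) iteration \<Rightarrow> bool" where
  "valid_transition p c S S' \<longleftrightarrow>
     it_x S' = (if successful p c S then final_trial p c S else it_x S) \<and>
     it_\<Delta> S' = (if successful p c S then min (par_\<gamma> p * it_\<Delta> S) (par_\<Delta>_max p)
                 else it_\<Delta> S / par_\<gamma> p) \<and>
     it_\<epsilon> S' = (if successful p c S \<and> - Pred p c S \<ge> it_\<epsilon> S then par_\<gamma> p * it_\<epsilon> S
                 else it_\<epsilon> S / par_\<gamma> p) \<and>
     it_\<mu> S' = mu_updated p c S"


section \<open>Randomness\<close>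

text \<open>
  \<open>Fpre k\<close> and \<open>Fmid k\<close> play the roles of the sigma-algebras \<open>F\<^sub>k\<^sub>-\<^sub>1\<close> (randomness before iteration
  \<open>k\<close>) and \<open>F\<^sub>k\<^sub>-\<^sub>0\<^sub>.\<^sub>5\<close> (additionally containing the estimates made before the trial step).
  Any filtration to which the run is adapted is allowed, in particular the one it generates.
\<close>

definition adapted_run ::
    "'w measure \<Rightarrow> (nat \<Rightarrow> 'w measure) \<Rightarrow> (nat \<Rightarrow> 'w measure)
      \<Rightarrow> (nat \<Rightarrow> 'w \<Rightarrow> ('d::finite, 'p::finite) iteration) \<Rightarrow> bool" where
  "adapted_run M Fpre Fmid run \<longleftrightarrow> (\<forall>k.
     subalgebra M (Fpre k) \<and> subalgebra M (Fmid k) \<and>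
     subalgebra (Fmid k) (Fpre k) \<and> subalgebra (Fpre (Suc k)) (Fmid k) \<and>
     (\<lambda>\<omega>. it_x (run k \<omega>)) \<in> borel_measurable (Fpre k) \<and>
     (\<lambda>\<omega>. it_\<Delta> (run k \<omega>)) \<in> borel_measurable (Fpre k) \<and>
     (\<lambda>\<omega>. it_\<epsilon> (run k \<omega>)) \<in> borel_measurable (Fpre k) \<and>
     (\<lambda>\<omega>. it_\<mu> (run k \<omega>)) \<in> borel_measurable (Fpre k) \<and>
     (\<lambda>\<omega>. it_g (run k \<omega>)) \<in> borel_measurable (Fmid k) \<and>
     (\<lambda>\<omega>. it_hess (run k \<omega>)) \<in> borel_measurable (Fmid k) \<and>
     (\<lambda>\<omega>. it_H (run k \<omega>)) \<in> borel_measurable (Fmid k) \<and>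
     (\<lambda>\<omega>. it_Z (run k \<omega>)) \<in> borel_measurable (Fmid k) \<and>
     (\<lambda>\<omega>. it_u (run k \<omega>)) \<in> borel_measurable (Fmid k) \<and>
     (\<lambda>\<omega>. it_f (run k \<omega>)) \<in> borel_measurable (Fpre (Suc k)) \<and>
     (\<lambda>\<omega>. it_fs (run k \<omega>)) \<in> borel_measurable (Fpre (Suc k)) \<and>
     (\<lambda>\<omega>. it_fsoc (run k \<omega>)) \<in> borel_measurable (Fpre (Suc k)))"

text \<open>\<open>P(A | N) \<ge> q\<close> almost surely on the event \<open>E\<close>.\<close>

definition cond_prob_ge_on ::
    "'w measure \<Rightarrow> 'w measure \<Rightarrow> 'w set \<Rightarrow> 'w set \<Rightarrow> real \<Rightarrow> bool" where
  "cond_prob_ge_on M N E A q \<longleftrightarrow>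
     (AE \<omega> in M. \<omega> \<in> E \<longrightarrow> real_cond_exp M N (indicator (A \<inter> E)) \<omega> \<ge> q)"

text \<open>
  Accuracy of the objective estimates \<open>it_f\<close> at the iterate and \<open>fs\<close> at the trial point \<open>xs\<close>. They
  are only made on the event \<open>E\<close>, which is known at the time of the conditioning.
\<close>

definition accurate_values ::
    "parameters \<Rightarrow> (real^'d \<Rightarrow> real) \<Rightarrow> 'w measure \<Rightarrow> 'w measure \<Rightarrow> 'w set \<Rightarrow> ('w \<Rightarrow> ('d::finite, 'p::finite) iteration)
      \<Rightarrow> ('w \<Rightarrow> real^'d) \<Rightarrow> ('w \<Rightarrow> real) \<Rightarrow> bool" where
  "accurate_values p f M N E S xs fs \<longleftrightarrow>
     cond_prob_ge_on M N E
       {\<omega> \<in> space M. max \<bar>it_f (S \<omega>) - f (it_x (S \<omega>))\<bar> \<bar>fs \<omega> - f (xs \<omega>)\<bar>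
                       \<le> par_\<kappa>_f p * it_\<Delta> (S \<omega>) ^ (par_\<alpha> p + 2)}
       (1 - par_p_f p) \<and>
     (AE \<omega> in M. \<omega> \<in> E \<longrightarrow>
        max (nn_cond_exp M N (\<lambda>\<omega>. ennreal (\<bar>it_f (S \<omega>) - f (it_x (S \<omega>))\<bar>\<^sup>2) * indicator E \<omega>) \<omega>)
            (nn_cond_exp M N (\<lambda>\<omega>. ennreal (\<bar>fs \<omega> - f (xs \<omega>)\<bar>\<^sup>2) * indicator E \<omega>) \<omega>)
          \<le> ennreal ((it_\<epsilon> (S \<omega>))\<^sup>2))"

definition accurate_estimates ::
    "parameters \<Rightarrow> (real^'d \<Rightarrow> real) \<Rightarrow> (real^'d \<Rightarrow> real^'m) \<Rightarrow> 'w measure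
      \<Rightarrow> (nat \<Rightarrow> 'w measure) \<Rightarrow> (nat \<Rightarrow> 'w measure) \<Rightarrow> (nat \<Rightarrow> 'w \<Rightarrow> ('d::finite, 'p::finite) iteration) \<Rightarrow> bool" where
  "accurate_estimates p f c M Fpre Fmid run \<longleftrightarrow> (\<forall>k.
     (par_\<alpha> p = 1 \<longrightarrow>
        cond_prob_ge_on M (Fpre k) (space M)
          {\<omega> \<in> space M. opnorm (it_hess (run k \<omega>) - hess f (it_x (run k \<omega>)))
                          \<le> par_\<kappa>_h p * it_\<Delta> (run k \<omega>)}
          (1 - par_p_h p)) \<and>
     cond_prob_ge_on M (Fpre k) (space M)
       {\<omega> \<in> space M. norm (it_g (run k \<omega>) - grad f (it_x (run k \<omega>)))
                       \<le> par_\<kappa>_g p * it_\<Delta> (run k \<omega>) ^ (par_\<alpha> p + 1)}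
       (1 - par_p_g p) \<and>
     (let E = {\<omega> \<in> space M. computes_step p c (run k \<omega>)} in
        accurate_values p f M (Fmid k) E (run k)
          (\<lambda>\<omega>. first_trial p c (run k \<omega>)) (\<lambda>\<omega>. it_fs (run k \<omega>)) \<and>
        accurate_values p f M (Fmid k) E (run k)
          (\<lambda>\<omega>. final_trial p c (run k \<omega>)) (\<lambda>\<omega>. final_estimate p c (run k \<omega>))))"

definition TR_SQP_STORM ::
    "parameters \<Rightarrow> (real^'d \<Rightarrow> real) \<Rightarrow> (real^'d \<Rightarrow> real^'m)
      \<Rightarrow> real^'d \<Rightarrow> real \<Rightarrow> real \<Rightarrow> real \<Rightarrow> 'w measure
      \<Rightarrow> (nat \<Rightarrow> 'w measure) \<Rightarrow> (nat \<Rightarrow> 'w measure) \<Rightarrow> (nat \<Rightarrow> 'w \<Rightarrow> ('d::finite, 'p::finite) iteration) \<Rightarrow> bool" where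
  "TR_SQP_STORM p f c x\<^sub>0 \<Delta>\<^sub>0 \<epsilon>\<^sub>0 \<mu>\<^sub>0 M Fpre Fmid run \<longleftrightarrow>
     valid_parameters p \<and> prob_space M \<and>
     \<Delta>\<^sub>0 \<in> {0<..<par_\<Delta>_max p} \<and> \<epsilon>\<^sub>0 > 0 \<and> \<mu>\<^sub>0 > 0 \<and>
     (\<forall>\<omega>\<in>space M.
        it_x (run 0 \<omega>) = x\<^sub>0 \<and> it_\<Delta> (run 0 \<omega>) = \<Delta>\<^sub>0 \<and>
        it_\<epsilon> (run 0 \<omega>) = \<epsilon>\<^sub>0 \<and> it_\<mu> (run 0 \<omega>) = \<mu>\<^sub>0 \<and>
        (\<forall>k. valid_iteration p c (run k \<omega>) \<and>
             valid_transition p c (run k \<omega>) (run (Suc k) \<omega>))) \<and>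
     adapted_run M Fpre Fmid run \<and>
     accurate_estimates p f c M Fpre Fmid run"


section \<open>The regularity assumption\<close>

text \<open>All constants and the set \<open>\<Omega>\<close> are deterministic; the bounds hold in every realization.\<close>

definition regularity ::
    "parameters \<Rightarrow> (real^'d \<Rightarrow> real) \<Rightarrow> (real^'d \<Rightarrow> real^'m) \<Rightarrow> 'w measure
      \<Rightarrow> (nat \<Rightarrow> 'w \<Rightarrow> ('d::finite, 'p::finite) iteration) \<Rightarrow> bool" where
  "regularity p f c M run \<longleftrightarrow>
     (\<exists>\<Omega>. open \<Omega> \<and> convex \<Omega> \<and>
        (\<forall>\<omega>\<in>space M. \<forall>k.
           it_x (run k \<omega>) \<in> \<Omega> \<and>
           (computes_step p c (run k \<omega>) \<longrightarrow>
              first_trial p c (run k \<omega>) \<in> \<Omega> \<and> final_trial p c (run k \<omega>) \<in> \<Omega>)) \<and>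
        C2_on \<Omega> f \<and>
        (\<exists>f_inf. \<forall>x\<in>\<Omega>. f_inf \<le> f x) \<and>
        (\<exists>L. L-lipschitz_on \<Omega> (grad f)) \<and>
        (\<exists>L. op_lipschitz_on L \<Omega> (hess f)) \<and>
        (\<forall>i. C2_on \<Omega> (\<lambda>x. c x $ i)) \<and>
        (\<exists>L. op_lipschitz_on L \<Omega> (Jac c)) \<and>
        (\<exists>L. \<forall>i. op_lipschitz_on L \<Omega> (hess (\<lambda>x. c x $ i)))) \<and>
     (\<exists>\<kappa>_c>0. \<exists>\<kappa>_grad>0. \<exists>\<kappa>_1G>0. \<exists>\<kappa>_2G>0. \<forall>\<omega>\<in>space M. \<forall>k.
        (let x = it_x (run k \<omega>); G = Jac c x in
           norm (c x) \<le> \<kappa>_c \<and> norm (grad f x) \<le> \<kappa>_grad \<and>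
           loewner_le (mat \<kappa>_1G) (G ** transpose G) \<and>
           loewner_le (G ** transpose G) (mat \<kappa>_2G))) \<and>
     (par_\<alpha> p = 0 \<longrightarrow> (\<exists>\<kappa>\<ge>1. \<forall>\<omega>\<in>space M. \<forall>k. opnorm (it_H (run k \<omega>)) \<le> \<kappa>))"

end

theory Submission
  imports Defs
begin

text \<open>
  For a trial step \<open>w + t\<close> with normal part \<open>w\<close> and tangential part \<open>t\<close>, the merit parameter \<open>\<mu>\<close>
  enters the predicted reduction only through \<open>- \<mu> * \<nu>\<close>, where \<open>\<nu>\<close> is the decrease of the linearized
  constraint violation. So a uniform threshold for \<open>\<mu>\<close> exists as soon as everything else that separates
  the prediction from the required decrease is at most a uniform constant times \<open>\<nu>\<close>.
  That holds for two reasons.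

  First, \<open>norm w\<close> is at most a constant times \<open>\<nu>\<close>, since \<open>w\<close> is a multiple of the
  minimum-norm solution of the linearized constraints and the Gram matrix of the Jacobian is bounded
  below (\<open>norm_normal_step_le\<close>). This absorbs all terms of the quadratic model that involve \<open>w\<close>
  (\<open>Pred_le\<close>). Second, the tangential step only achieves a decrease for its own share of the
  trust region, whereas the required decrease is measured with the full radius and with the full KKT
  residual. Let \<open>B\<close> be the rescaled constraint violation, \<open>A\<close> the rescaled tangential measure
  (projected gradient or negative curvature), and \<open>N = sqrt (A\<^sup>2 + B\<^sup>2)\<close>; let
  \<open>\<theta> = min \<Delta> N / N\<close> be the factor that brings the pair \<open>(A, B)\<close> into the trust region.
  The gap between required and achieved decrease is at most a constant times \<open>\<theta> * B\<close>
  (\<open>gradient_decrease_split\<close>, \<open>eigen_decrease_split\<close>), and \<open>\<nu>\<close> is at least a constant times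
  \<open>\<theta> * B\<close> (\<open>normal_decrease_ge\<close>).

  Above the threshold the merit parameter is accepted at once, so its values never exceed a
  deterministic bound. Each update multiplies it by a power of \<open>\<rho> > 1\<close>, so only finitely many
  updates are nontrivial, and the first index after which none occurs is a measurable function of the
  realization.
\<close>

(* It would turn transposes into the left action v*, for which the adjoint identity below does not fire. *)
declare transpose_matrix_vector [simp del]

section \<open>Operator norms and well-conditioned matrices\<close>

lemma norm_mult_le_opnorm: "norm (A *v x) \<le> opnorm A * norm x"
  unfolding opnorm_def by (rule onorm) (rule matrix_vector_mul_bounded_linear)

lemma opnorm_nonneg: "0 \<le> opnorm A"
  unfolding opnorm_def by (rule onorm_pos_le) (rule matrix_vector_mul_bounded_linear)

lemma opnorm_le: "(\<And>x. norm (A *v x) \<le> b * norm x) \<Longrightarrow> opnorm A \<le> b"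
  unfolding opnorm_def by (rule onorm_le)

lemma inner_transpose_mult: "(transpose A *v y) \<bullet> x = y \<bullet> (A *v (x :: real^_))"
  by (simp add: transpose_matrix_vector dot_lmul_matrix)

lemma abs_bilinear_le: "\<bar>x \<bullet> (A *v y)\<bar> \<le> opnorm A * norm x * norm y"
proof -
  have "\<bar>x \<bullet> (A *v y)\<bar> \<le> norm x * norm (A *v y)"
    by (rule Cauchy_Schwarz_ineq2)
  also have "\<dots> \<le> norm x * (opnorm A * norm y)"
    by (intro mult_left_mono norm_mult_le_opnorm) simp
  finally show ?thesis by (simp add: mult_ac)
qed

lemma mat_mult_vec: "mat k *v x = k *\<^sub>R (x :: real^'n)"
  by (simp add: vec_eq_iff mat_def matrix_vector_mult_def if_distrib if_distribR sum.delta cong: if_cong)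

lemma gram_quadratic_form: "y \<bullet> ((A ** transpose A) *v y) = (norm (transpose A *v (y :: real^_)))\<^sup>2"
  by (simp add: matrix_vector_mul_assoc [symmetric] inner_transpose_mult [symmetric] dot_square_norm)

lemma norm_transpose_mult_ge:
  assumes "loewner_le (mat k) (A ** transpose A)" and "0 \<le> k"
  shows "sqrt k * norm y \<le> norm (transpose A *v y)"
proof -
  have "(sqrt k * norm y)\<^sup>2 \<le> (norm (transpose A *v y))\<^sup>2"
    using assms
    by (simp add: loewner_le_def gram_quadratic_form mat_mult_vec power_mult_distrib dot_square_norm)
  then show ?thesis by (rule power2_le_imp_le) simp
qed

text \<open>The Gram matrix bounds the transpose, and a matrix and its transpose have the same operator norm;
  the proof is the adjoint argument for one of the two inequalities.\<close>

lemma opnorm_le_sqrt_gram: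
  assumes "loewner_le (A ** transpose A) (mat k)"
  shows "opnorm A \<le> sqrt k"
proof (rule opnorm_le)
  fix x
  have k: "k * (norm y)\<^sup>2 \<ge> (norm (transpose A *v y))\<^sup>2" for y
    using assms by (simp add: loewner_le_def gram_quadratic_form mat_mult_vec dot_square_norm)
  have "k \<ge> 0"
    using k[of "axis undefined 1"] by (simp add: norm_axis_1) (meson order_trans zero_le_power2)
  let ?y = "A *v x"
  have "norm (transpose A *v ?y) \<le> sqrt k * norm ?y"
    by (rule power2_le_imp_le) (use k[of ?y] \<open>k \<ge> 0\<close> in \<open>auto simp: power_mult_distrib\<close>)
  then have "norm ?y * norm ?y \<le> sqrt k * norm ?y * norm x"
    using norm_cauchy_schwarz[of "transpose A *v ?y" x] mult_right_mono[of "norm (transpose A *v ?y)" "sqrt k * norm ?y" "norm x"]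
    by (simp add: inner_transpose_mult dot_square_norm power2_eq_square)
  then show "norm (A *v x) \<le> sqrt k * norm x"
    by (cases "A *v x = 0") (use \<open>k \<ge> 0\<close> in \<open>auto simp: mult_ac\<close>)
qed

lemma sqrt_le_opnorm_gram:
  assumes "loewner_le (mat k) (A ** transpose A)" and "0 \<le> k"
  shows "sqrt k \<le> opnorm A"
proof -
  let ?y = "axis undefined 1 :: real^_"
  let ?t = "norm (transpose A *v ?y)"
  have "?t * ?t \<le> opnorm A * ?t"
    using abs_bilinear_le[of ?y A "transpose A *v ?y"]
    by (simp add: inner_transpose_mult [symmetric] dot_square_norm power2_eq_square norm_axis_1)
  then have "?t \<le> opnorm A"
    using opnorm_nonneg[of A] by (cases "?t = 0") auto
  then show ?thesis
    using norm_transpose_mult_ge[OF assms, of ?y] by (simp add: norm_axis_1)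
qed

lemma gram_mult_inverse:
  assumes "loewner_le (mat k) (A ** transpose A)" and "0 < k"
  shows "A *v (transpose A *v (matrix_inv (A ** transpose A) *v y)) = y"
proof -
  let ?B = "A ** transpose A"
  have "inj ((*v) ?B)"
    unfolding vec.inj_iff_eq_0
  proof (intro allI impI)
    fix x assume "?B *v x = 0"
    then have "transpose A *v x = 0"
      using gram_quadratic_form[of x A] by simp
    then have "sqrt k * norm x \<le> 0"
      using norm_transpose_mult_ge[OF assms(1), of x] assms(2) by simp
    then show "x = 0" using assms(2) by (simp add: mult_le_0_iff)
  qed
  then obtain C where "C ** ?B = mat 1"
    using matrix_left_invertible_injective by blast
  then have "invertible ?B"
    unfolding invertible_def using matrix_left_right_inverse by blast
  then have "?B ** matrix_inv ?B = mat 1"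
    unfolding invertible_def matrix_inv_def by (rule someI2_ex) blast
  then show ?thesis
    by (simp add: matrix_vector_mul_assoc matrix_mul_assoc)
qed

text \<open>Writing \<open>z\<close> for the inverse Gram matrix applied to \<open>y\<close>, the squared norm of the minimum-norm
  solution is \<open>z \<bullet> y\<close>, and \<open>z\<close> in turn is controlled by that solution through \<open>norm_transpose_mult_ge\<close>.\<close>

lemma norm_minimal_solution_le:
  assumes "loewner_le (mat k) (A ** transpose A)" and "0 < k"
  shows "sqrt k * norm (transpose A *v (matrix_inv (A ** transpose A) *v y)) \<le> norm y"
proof -
  define z where "z = matrix_inv (A ** transpose A) *v y"
  let ?t = "norm (transpose A *v z)"
  have "?t * ?t = z \<bullet> y"
    using gram_mult_inverse[OF assms, of y] inner_transpose_mult[of A z "transpose A *v z"]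
    by (simp add: z_def dot_square_norm power2_eq_square)
  also have "\<dots> \<le> norm z * norm y" by (rule norm_cauchy_schwarz)
  finally have "sqrt k * (?t * ?t) \<le> sqrt k * (norm z * norm y)"
    using assms(2) by (intro mult_left_mono) auto
  also have "\<dots> = (sqrt k * norm z) * norm y" by simp
  also have "\<dots> \<le> ?t * norm y"
    using assms by (intro mult_right_mono norm_transpose_mult_ge) auto
  finally have "?t * (sqrt k * ?t) \<le> ?t * norm y" by (simp add: mult_ac)
  then show ?thesis
    by (cases "?t = 0") (auto simp: z_def)
qed

lemma norm_orthonormal_mult:
  assumes "transpose Z ** Z = mat 1"
  shows "norm (Z *v u) = norm (u :: real^_)"
proof -
  have "(Z *v u) \<bullet> (Z *v u) = u \<bullet> u"
    using assms inner_transpose_mult[of Z "Z *v u" u]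
    by (simp add: matrix_vector_mul_assoc)
  then show ?thesis by (simp add: norm_eq)
qed

lemma norm_orthonormal_transpose_mult_le:
  assumes "transpose Z ** Z = mat 1"
  shows "norm (transpose Z *v y) \<le> norm (y :: real^_)"
proof -
  let ?t = "transpose Z *v y"
  have "norm ?t * norm ?t = y \<bullet> (Z *v ?t)"
    using inner_transpose_mult[of Z y ?t] by (simp add: dot_square_norm power2_eq_square)
  also have "\<dots> \<le> norm y * norm ?t"
    using norm_cauchy_schwarz[of y "Z *v ?t"] norm_orthonormal_mult[OF assms, of ?t] by simp
  finally show ?thesis by (cases "?t = 0") auto
qed

lemma span_columns_eq_range: "span (columns A) = range ((*v) (A :: real^'n^'m))"
proof
  have "columns A \<subseteq> range ((*v) A)"
    by (auto simp: columns_image_basis)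
  moreover have "subspace (range ((*v) A))"
    by (intro linear_subspace_image matrix_vector_mul_linear subspace_UNIV)
  ultimately show "span (columns A) \<subseteq> range ((*v) A)" by (rule span_minimal)
qed (auto intro: matrix_vector_mult_in_columnspace)


section \<open>Elementary inequalities\<close>

text \<open>
  The Cauchy decrease \<open>x * min D (x / h)\<close> of a model with gradient norm \<open>x\<close> and curvature \<open>h\<close> in a
  trust region of radius \<open>D\<close> is Lipschitz in \<open>x\<close>. It transfers the decrease from the shifted gradient
  used for the step to the projected gradient in the KKT residual.
\<close>

lemma decrease_function_lipschitz:
  fixes L q e h D :: real
  assumes "0 \<le> q" "0 \<le> L" "0 \<le> e" "0 < h" "0 \<le> D" "L \<le> q + e"
  shows "L * min D (L / h) \<le> q * min D (q / h) + e * (D + L / h)"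
proof (cases "L \<le> q")
  case True
  then have "L * min D (L / h) \<le> q * min D (q / h)"
    using assms by (intro mult_mono min.mono divide_right_mono) auto
  moreover have "0 \<le> e * (D + L / h)" using assms by simp
  ultimately show ?thesis by linarith
next
  case False
  have "(L - q) * min D (L / h) \<le> e * D"
    using assms False by (intro mult_mono) auto
  moreover have "q * (min D (L / h) - min D (q / h)) \<le> L * (e / h)"
  proof (intro mult_mono)
    have "L / h - q / h \<le> e / h"
      using assms by (simp add: diff_divide_distrib [symmetric] divide_right_mono)
    moreover have "0 \<le> e / h" using assms by simp
    ultimately show "min D (L / h) - min D (q / h) \<le> e / h"
      by (auto simp: min_def)
    have "q / h \<le> L / h" using assms False by (intro divide_right_mono) auto
    then show "0 \<le> min D (L / h) - min D (q / h)" by (auto simp: min_def)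
  qed (use False assms in auto)
  ultimately show ?thesis by (simp add: algebra_simps)
qed

text \<open>
  With \<open>\<theta> = min D N / N\<close>, the left side is at most \<open>h * \<theta> * N\<^sup>2\<close> up to a term of order \<open>B\<^sup>2\<close>, because
  the residual \<open>K\<close> and the number \<open>h * N\<close> differ only in the weight of \<open>B\<close>; the first term on the right
  equals \<open>h * \<theta> * A\<^sup>2\<close>. Their difference is again of order \<open>B\<^sup>2\<close>.
\<close>

lemma gradient_decrease_split:
  fixes A B h g D :: real
  assumes "0 \<le> A" "0 \<le> B" "0 < h" "0 \<le> D" and N: "N = sqrt (A\<^sup>2 + B\<^sup>2)"
    and K: "K = sqrt ((h * A)\<^sup>2 + (g * B)\<^sup>2)"
  shows "K * min D (K / h) \<le> h * A * min (D * A / N) A + min D N / N * B\<^sup>2 * (h + g\<^sup>2 / h)"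
proof (cases "N = 0")
  case True
  then have "A = 0" "B = 0" by (auto simp: N sum_power2_eq_zero_iff)
  then show ?thesis by (simp add: K)
next
  case False
  define \<theta> where "\<theta> = min D N / N"
  have Npos: "0 < N" using False by (simp add: N less_le)
  have \<theta>: "0 \<le> \<theta>" "\<theta> * N = min D N" using Npos assms by (auto simp: \<theta>_def)
  have N2: "N\<^sup>2 = A\<^sup>2 + B\<^sup>2" and K2: "K\<^sup>2 = h\<^sup>2 * A\<^sup>2 + g\<^sup>2 * B\<^sup>2" and "0 \<le> K"
    by (auto simp: N K power_mult_distrib)
  have "K * min D (K / h) \<le> h * \<theta> * N\<^sup>2 + \<theta> * g\<^sup>2 * B\<^sup>2 / h"
  proof (cases "K \<le> h * N")
    case True
    then have "K / h \<le> N" using assms by (simp add: field_simps)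
    then have "K * min D (K / h) \<le> (h * N) * min D N"
      using True \<open>0 \<le> K\<close> assms by (intro mult_mono) auto
    also have "\<dots> = h * \<theta> * N\<^sup>2" by (simp add: \<theta>(2) [symmetric] power2_eq_square)
    also have "\<dots> \<le> h * \<theta> * N\<^sup>2 + \<theta> * g\<^sup>2 * B\<^sup>2 / h" using \<theta> assms by simp
    finally show ?thesis .
  next
    case False
    then have KN: "N \<le> K / h" using assms by (simp add: field_simps)
    have "min D (K / h) \<le> \<theta> * (K / h)"
    proof (cases "D \<le> N")
      case True
      have "\<theta> * N \<le> \<theta> * (K / h)" using KN \<theta> by (intro mult_left_mono)
      then show ?thesis using True \<theta> by simp
    next
      case False
      then show ?thesis using Npos by (simp add: \<theta>_def)
    qed
    then have "K * min D (K / h) \<le> K * (\<theta> * (K / h))"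
      using \<open>0 \<le> K\<close> by (rule mult_left_mono)
    also have "\<dots> = \<theta> * K\<^sup>2 / h" by (simp add: power2_eq_square)
    also have "\<dots> = h * \<theta> * A\<^sup>2 + \<theta> * g\<^sup>2 * B\<^sup>2 / h"
      using assms by (simp add: K2 field_simps power2_eq_square)
    also have "\<dots> \<le> h * \<theta> * N\<^sup>2 + \<theta> * g\<^sup>2 * B\<^sup>2 / h"
      using \<theta> assms by (auto simp: N2 intro!: mult_left_mono)
    finally show ?thesis .
  qed
  also have "\<dots> = h * A * (\<theta> * A) + \<theta> * B\<^sup>2 * (h + g\<^sup>2 / h)"
    unfolding N2 by (simp add: algebra_simps power2_eq_square)
  also have "\<theta> * A = min (D * A / N) A"
  proof (cases "D \<le> N")
    case True
    then have "D * A \<le> N * A" using assms by (intro mult_right_mono)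
    then show ?thesis using True Npos by (simp add: \<theta>_def field_simps)
  next
    case False
    then have "N * A \<le> D * A" using assms by (intro mult_right_mono) auto
    then show ?thesis using False Npos by (simp add: \<theta>_def field_simps)
  qed
  finally show ?thesis by (simp add: \<theta>_def)
qed

text \<open>
  Pythagoras splits the squared radius into the tangential and the normal share. The normal share
  and the mixed term \<open>D * g * B\<close> both carry the factor \<open>D * B\<close>, and \<open>D\<close> is at most
  \<open>min D N / N * (D + N)\<close>.
\<close>

lemma eigen_decrease_split:
  fixes A B h g D :: real
  assumes "0 \<le> A" "0 \<le> B" "0 \<le> h" "0 \<le> g" "0 \<le> D" and N: "N = sqrt (A\<^sup>2 + B\<^sup>2)" and "0 < N"
  shows "A * (D * (D + g * B)) \<le> A * (D * A / N)\<^sup>2 + min D N / N * B * ((D + N) * (D + A * g))"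
proof -
  define \<theta> where "\<theta> = min D N / N"
  have N2: "N\<^sup>2 = A\<^sup>2 + B\<^sup>2" by (simp add: N)
  have D: "D \<le> \<theta> * (D + N)"
    using assms(5,7) by (auto simp: \<theta>_def min_def field_simps)
  have AB: "A * B \<le> N\<^sup>2"
    using assms sum_squares_bound[of A B] mult_nonneg_nonneg[of A B] by (simp add: N2)
  have "D\<^sup>2 = (D * A / N)\<^sup>2 + (D * B / N)\<^sup>2"
    using assms(7) by (simp add: power_divide power_mult_distrib add_divide_distrib [symmetric]
        distrib_left [symmetric] N2 [symmetric])
  then have "A * D\<^sup>2 = A * (D * A / N)\<^sup>2 + A * (D * B / N)\<^sup>2"
    by (simp only: distrib_left)
  then have "A * (D * (D + g * B)) = A * (D * A / N)\<^sup>2 + A * (D * B / N)\<^sup>2 + D * (A * g * B)"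
    by (simp add: distrib_left power2_eq_square mult_ac)
  also have "A * (D * B / N)\<^sup>2 = D * (D * B) * (A * B / N\<^sup>2)"
    by (simp add: power2_eq_square)
  also have "\<dots> \<le> D * (D * B) * 1"
    using assms AB by (intro mult_left_mono) auto
  also have "A * (D * A / N)\<^sup>2 + D * (D * B) * 1 + D * (A * g * B) =
      A * (D * A / N)\<^sup>2 + D * (B * (D + A * g))"
    by (simp add: algebra_simps)
  also have "D * (B * (D + A * g)) \<le> \<theta> * (D + N) * (B * (D + A * g))"
    using assms D by (intro mult_right_mono) auto
  finally show ?thesis by (simp add: \<theta>_def mult_ac)
qed


section \<open>A uniform merit threshold for one iteration\<close>

text \<open>
  One iteration that computes a step, with all realized quantities inside bounds that will be the
  same for every iteration and every realization.
\<close>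

locale bounded_iteration =
  fixes p :: parameters
    and c :: "real^'d \<Rightarrow> real^'m"
    and S :: "('d::finite, 'p::finite) iteration"
    and \<kappa>\<^sub>1 \<kappa>\<^sub>2 \<kappa>\<^sub>c \<kappa>\<^sub>g \<kappa>\<^sub>B D :: real
  assumes fcd: "0 < par_\<kappa>_fcd p" "par_\<kappa>_fcd p \<le> 1"
    and gram_ge: "loewner_le (mat \<kappa>\<^sub>1) (Jac c (it_x S) ** transpose (Jac c (it_x S)))"
    and gram_le: "loewner_le (Jac c (it_x S) ** transpose (Jac c (it_x S))) (mat \<kappa>\<^sub>2)"
    and \<kappa>\<^sub>1: "0 < \<kappa>\<^sub>1"
    and c_le: "norm (c (it_x S)) \<le> \<kappa>\<^sub>c"
    and g_le: "norm (it_g S) \<le> \<kappa>\<^sub>g"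
    and H_ge: "1 / \<kappa>\<^sub>B \<le> opnorm (it_H S)"
    and H_le: "opnorm (it_H S) \<le> \<kappa>\<^sub>B"
    and \<kappa>\<^sub>B: "0 < \<kappa>\<^sub>B"
    and radius: "0 < it_\<Delta> S" "it_\<Delta> S \<le> D"
    and orthonormal: "transpose (it_Z S) ** it_Z S = mat 1"
    and kernel: "span (columns (it_Z S)) = {y. Jac c (it_x S) *v y = 0}"
    and tangential: "valid_tangential p c S"
begin

abbreviation "G \<equiv> Jac c (it_x S)"
abbreviation "h \<equiv> opnorm (it_H S)"
abbreviation "w \<equiv> normal_step p c S"
abbreviation "t \<equiv> it_Z S *v it_u S"
abbreviation "\<tau> \<equiv> tau_plus p S"

definition normal_fraction :: real where
  "normal_fraction = min (normal_radius p c S / norm (normal_dir c S)) 1"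

text \<open>The decrease of the linearized constraint violation, the quantity multiplied by the merit
  parameter (see \<open>linearized_feasibility\<close>).\<close>

definition normal_decrease :: real where
  "normal_decrease = normal_fraction * norm (c (it_x S))"

lemma h_pos: "0 < h"
  using H_ge \<kappa>\<^sub>B by (meson divide_pos_pos less_le_trans zero_less_one)

lemma inverse_h_le: "1 / h \<le> \<kappa>\<^sub>B"
  using H_ge h_pos \<kappa>\<^sub>B by (simp add: divide_le_eq mult.commute)

lemma G_ge: "sqrt \<kappa>\<^sub>1 \<le> opnorm G"
  using gram_ge \<kappa>\<^sub>1 by (intro sqrt_le_opnorm_gram) auto

lemma G_le: "opnorm G \<le> sqrt \<kappa>\<^sub>2"
  using gram_le by (rule opnorm_le_sqrt_gram)

lemma G_pos: "0 < opnorm G"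
  using G_ge \<kappa>\<^sub>1 by (meson less_le_trans real_sqrt_gt_zero)

lemma bounds_nonneg: "0 \<le> \<kappa>\<^sub>c" "0 \<le> \<kappa>\<^sub>g" "0 \<le> D"
  using c_le g_le radius norm_ge_zero[of "c (it_x S)"] norm_ge_zero[of "it_g S"] by linarith+

lemma tau_nonneg: "0 \<le> \<tau>"
  by (simp add: tau_plus_def)

lemma normal_dir_solves: "G *v normal_dir c S = - c (it_x S)"
  using gram_mult_inverse[OF gram_ge \<kappa>\<^sub>1, of "c (it_x S)"]
  by (simp add: normal_dir_def Let_def vec.neg)

lemma norm_normal_dir_le: "sqrt \<kappa>\<^sub>1 * norm (normal_dir c S) \<le> norm (c (it_x S))"
  using norm_minimal_solution_le[OF gram_ge \<kappa>\<^sub>1, of "c (it_x S)"]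
  by (simp add: normal_dir_def Let_def)

lemma radii_nonneg: "0 \<le> normal_radius p c S" "0 \<le> tangential_radius p c S"
  using radius tau_nonneg h_pos
  by (auto simp: normal_radius_def tangential_radius_def tau_RS_def intro!: divide_nonneg_nonneg mult_nonneg_nonneg)

lemma normal_fraction_bounds: "0 \<le> normal_fraction" "normal_fraction \<le> 1"
  using radii_nonneg by (auto simp: normal_fraction_def)

lemma normal_decrease_bounds: "0 \<le> normal_decrease" "normal_decrease \<le> \<kappa>\<^sub>c"
  using normal_fraction_bounds c_le mult_mono[of normal_fraction 1 "norm (c (it_x S))" \<kappa>\<^sub>c]
  by (auto simp: normal_decrease_def)

text \<open>The normal direction and the decrease it brings are scaled by the same factor, so short
  normal steps are compared with equally small decreases.\<close>

lemma norm_normal_step_le: "norm w \<le> normal_decrease / sqrt \<kappa>\<^sub>1"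
proof -
  have "sqrt \<kappa>\<^sub>1 * norm w = normal_fraction * (sqrt \<kappa>\<^sub>1 * norm (normal_dir c S))"
    using normal_fraction_bounds by (simp add: normal_step_def normal_fraction_def [symmetric])
  also have "\<dots> \<le> normal_decrease"
    unfolding normal_decrease_def by (intro mult_left_mono norm_normal_dir_le normal_fraction_bounds)
  finally show ?thesis using \<kappa>\<^sub>1 by (simp add: field_simps)
qed

lemma tangential_in_kernel: "G *v t = 0"
  using kernel matrix_vector_mult_in_columnspace[of "it_Z S" "it_u S"] by blast

lemma linearized_feasibility:
  "norm (c (it_x S) + G *v trial_step p c S) - norm (c (it_x S)) = - normal_decrease"
proof -
  have "c (it_x S) + G *v trial_step p c S = (1 - normal_fraction) *\<^sub>R c (it_x S)"
    by (simp add: trial_step_def matrix_vector_right_distrib tangential_in_kernel normal_step_def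
        normal_fraction_def [symmetric] matrix_vector_mult_scaleR normal_dir_solves algebra_simps)
  then show ?thesis
    using normal_fraction_bounds by (simp add: normal_decrease_def left_diff_distrib)
qed

lemma norm_tangential_step: "norm t \<le> tangential_radius p c S"
  using tangential by (simp add: valid_tangential_def norm_orthonormal_mult[OF orthonormal])

lemma tangential_radius_le: "tangential_radius p c S \<le> D"
proof -
  have frac: "x / sqrt (x\<^sup>2 + y\<^sup>2) \<le> 1" if "0 \<le> x" for x y :: real
  proof -
    have "x \<le> sqrt (x\<^sup>2 + y\<^sup>2)" using that by (intro real_le_rsqrt) simp
    then show ?thesis by (auto simp: divide_le_eq_1 not_sum_power2_lt_zero sum_power2_gt_zero_iff)
  qed
  have "norm (gradL_RS c S) / norm (gradL_RS c S, c_RS c S) \<le> 1"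
    unfolding norm_Pair by (rule frac) simp
  moreover have "tau_RS p S / norm (c_RS c S, tau_RS p S) \<le> 1"
    unfolding norm_Pair using frac[of "tau_RS p S" "norm (c_RS c S)"] tau_nonneg h_pos
    by (simp add: tau_RS_def add.commute)
  ultimately have "tangential_radius p c S \<le> it_\<Delta> S * 1"
    unfolding tangential_radius_def times_divide_eq_right [symmetric]
    using radius by (simp only: split: if_split) (blast intro: mult_left_mono less_imp_le)
  then show ?thesis using radius by simp
qed

text \<open>
  All terms of the quadratic model that are not part of the tangential model contain the normal step
  and hence are bounded by its norm.
\<close>

lemma Pred_le:
  "Pred_at p c S \<mu> \<le>
     normal_decrease * ((\<kappa>\<^sub>g + \<kappa>\<^sub>B * (\<kappa>\<^sub>c / sqrt \<kappa>\<^sub>1) + \<kappa>\<^sub>B * D) / sqrt \<kappa>\<^sub>1 - \<mu>)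
     + tangential_model p c S (it_u S)"
proof -
  let ?H = "it_H S"
  \<comment> \<open>The tangential model contains the mixed term as \<open>t \<bullet> (?H *v w)\<close>; for a model Hessian that is
    not symmetric the antisymmetric remainder stays, and it is also of order \<open>norm w\<close>.\<close>
  have eq: "Pred_at p c S \<mu> = it_g S \<bullet> w + 1/2 * (w \<bullet> (?H *v w))
      + 1/2 * (w \<bullet> (?H *v t) - t \<bullet> (?H *v w)) + tangential_model p c S (it_u S) - \<mu> * normal_decrease"
    unfolding Pred_at_def Let_def linearized_feasibility
    by (simp add: trial_step_def tangential_model_def shifted_grad_def inner_add_left inner_add_right
        matrix_vector_right_distrib inner_commute algebra_simps)
  have "it_g S \<bullet> w \<le> norm w * \<kappa>\<^sub>g"
    using norm_cauchy_schwarz[of "it_g S" w] mult_right_mono[OF g_le, of "norm w"]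
    by (simp add: mult.commute)
  moreover have nw: "norm w \<le> \<kappa>\<^sub>c / sqrt \<kappa>\<^sub>1"
    using norm_normal_step_le normal_decrease_bounds(2) \<kappa>\<^sub>1
    by (meson divide_right_mono order_trans real_sqrt_ge_zero less_imp_le)
  moreover have nt: "norm t \<le> D"
    using norm_tangential_step tangential_radius_le by linarith
  have hb: "h * norm x * norm w \<le> norm w * (\<kappa>\<^sub>B * y)" if "norm x \<le> y" for x :: "real^'d" and y
  proof -
    have "h * norm x \<le> \<kappa>\<^sub>B * y" using that H_le h_pos \<kappa>\<^sub>B by (intro mult_mono) auto
    then have "(h * norm x) * norm w \<le> (\<kappa>\<^sub>B * y) * norm w" by (rule mult_right_mono) simp
    then show ?thesis by (simp only: mult.commute)
  qed
  have "w \<bullet> (?H *v w) \<le> norm w * (\<kappa>\<^sub>B * (\<kappa>\<^sub>c / sqrt \<kappa>\<^sub>1))"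
    using abs_bilinear_le[of w ?H w] hb[OF nw] by linarith
  moreover have "0 \<le> norm w * (\<kappa>\<^sub>B * (\<kappa>\<^sub>c / sqrt \<kappa>\<^sub>1))"
    using bounds_nonneg \<kappa>\<^sub>B \<kappa>\<^sub>1 by simp
  moreover have "w \<bullet> (?H *v t) - t \<bullet> (?H *v w) \<le> 2 * (norm w * (\<kappa>\<^sub>B * D))"
    using abs_bilinear_le[of w ?H t] abs_bilinear_le[of t ?H w] hb[OF nt]
    by (simp add: mult_ac)
  ultimately have "Pred_at p c S \<mu> \<le>
      norm w * (\<kappa>\<^sub>g + \<kappa>\<^sub>B * (\<kappa>\<^sub>c / sqrt \<kappa>\<^sub>1) + \<kappa>\<^sub>B * D) + tangential_model p c S (it_u S) - \<mu> * normal_decrease"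
  proof -
    have "a + 1/2 * b + 1/2 * d + m - n \<le> a' + b' + d' + m - n"
      if "a \<le> a'" "b \<le> b'" "0 \<le> b'" "d \<le> 2 * d'" for a a' b b' d d' m n :: real
      using that by simp
    then show ?thesis
      unfolding eq distrib_left
      using \<open>it_g S \<bullet> w \<le> _\<close> \<open>w \<bullet> (?H *v w) \<le> _\<close> \<open>0 \<le> norm w * _\<close> \<open>w \<bullet> (?H *v t) - _ \<le> _\<close>
      by blast
  qed
  also have "norm w * (\<kappa>\<^sub>g + \<kappa>\<^sub>B * (\<kappa>\<^sub>c / sqrt \<kappa>\<^sub>1) + \<kappa>\<^sub>B * D) \<le>
      normal_decrease / sqrt \<kappa>\<^sub>1 * (\<kappa>\<^sub>g + \<kappa>\<^sub>B * (\<kappa>\<^sub>c / sqrt \<kappa>\<^sub>1) + \<kappa>\<^sub>B * D)"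
    using bounds_nonneg \<kappa>\<^sub>B \<kappa>\<^sub>1 by (intro mult_right_mono norm_normal_step_le) auto
  finally have le: "Pred_at p c S \<mu> \<le> normal_decrease / sqrt \<kappa>\<^sub>1 * (\<kappa>\<^sub>g + \<kappa>\<^sub>B * (\<kappa>\<^sub>c / sqrt \<kappa>\<^sub>1) + \<kappa>\<^sub>B * D)
      + tangential_model p c S (it_u S) - \<mu> * normal_decrease"
    by simp
  have rearrange: "x / a * y + m - \<mu> * x = x * (y / a - \<mu>) + m" for x a y m :: real
    by (simp add: right_diff_distrib)
  show ?thesis using le unfolding rearrange .
qed

lemma norm_c_eq: "norm (c (it_x S)) = opnorm G * norm (c_RS c S)"
  using G_pos by (simp add: c_RS_def)

lemma norm_c_RS_le: "norm (c_RS c S) \<le> \<kappa>\<^sub>c / sqrt \<kappa>\<^sub>1"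
proof -
  have "sqrt \<kappa>\<^sub>1 * norm (c_RS c S) \<le> \<kappa>\<^sub>c"
    using c_le mult_right_mono[OF G_ge, of "norm (c_RS c S)"] by (simp add: norm_c_eq)
  then show ?thesis using \<kappa>\<^sub>1 by (simp add: field_simps)
qed

text \<open>
  Here \<open>N\<close> stands for the norm of the rescaled pair of the tangential measure and the constraint
  violation, for either kind of step. If the normal step is cut off at its radius, the decrease is
  proportional to that radius, which gives the factor \<open>it_\<Delta> S / N\<close>; if it is not, the whole violation
  is removed, which gives the factor \<open>1\<close>.
\<close>

lemma normal_decrease_ge:
  assumes "normal_radius p c S = it_\<Delta> S * norm (c_RS c S) / N" and "0 \<le> N"
  shows "min (it_\<Delta> S) N / N * norm (c_RS c S) \<le> normal_decrease / sqrt \<kappa>\<^sub>1"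
proof (cases "N = 0 \<or> c (it_x S) = 0")
  case True
  then show ?thesis using normal_decrease_bounds \<kappa>\<^sub>1 by (auto simp: c_RS_def)
next
  case False
  let ?v = "norm (normal_dir c S)" and ?B = "norm (c_RS c S)" and ?\<theta> = "min (it_\<Delta> S) N / N"
  have "normal_dir c S \<noteq> 0" using False normal_dir_solves by force
  then have v: "0 < ?v" by simp
  have N: "0 < N" using False assms by simp
  have "sqrt \<kappa>\<^sub>1 * (?\<theta> * ?B) \<le> normal_decrease"
  proof (cases "normal_radius p c S / ?v \<le> 1")
    case True
    have "sqrt \<kappa>\<^sub>1 * (?\<theta> * ?B) \<le> sqrt \<kappa>\<^sub>1 * (it_\<Delta> S / N * ?B)"
      using \<kappa>\<^sub>1 N by (intro mult_left_mono mult_right_mono divide_right_mono) auto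
    also have "\<dots> = normal_radius p c S / ?v * (sqrt \<kappa>\<^sub>1 * ?v)"
      using v by (simp add: assms(1))
    also have "\<dots> \<le> normal_radius p c S / ?v * norm (c (it_x S))"
      using radii_nonneg v by (intro mult_left_mono norm_normal_dir_le) auto
    also have "\<dots> = normal_decrease"
      using True by (simp add: normal_decrease_def normal_fraction_def)
    finally show ?thesis .
  next
    case False
    have "?\<theta> \<le> 1" using N by (simp add: divide_le_eq_1)
    then have "sqrt \<kappa>\<^sub>1 * (?\<theta> * ?B) \<le> opnorm G * (1 * ?B)"
      using radius N G_ge G_pos by (intro mult_mono mult_right_mono) auto
    also have "\<dots> = normal_decrease"
      using False by (simp add: normal_decrease_def normal_fraction_def norm_c_eq)
    finally show ?thesis .
  qed
  then show ?thesis using \<kappa>\<^sub>1 by (simp add: field_simps)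
qed

lemma reduced_hess_le: "opnorm (reduced_hess S) \<le> h"
proof (rule opnorm_le)
  fix x
  have "norm (reduced_hess S *v x) \<le> norm (it_H S *v (it_Z S *v x))"
    using norm_orthonormal_transpose_mult_le[OF orthonormal]
    by (simp add: reduced_hess_def matrix_vector_mul_assoc [symmetric])
  also have "\<dots> \<le> h * norm x"
    using norm_mult_le_opnorm[of "it_H S" "it_Z S *v x"] by (simp add: norm_orthonormal_mult[OF orthonormal])
  finally show "norm (reduced_hess S *v x) \<le> h * norm x" .
qed

lemma gradL_in_kernel: "G *v gradL_bar c S = 0"
  using gram_mult_inverse[OF gram_ge \<kappa>\<^sub>1, of "G *v it_g S"]
  by (simp add: gradL_bar_def lam_bar_def Let_def matrix_vector_mult_diff_distrib vec.neg)

lemma gradL_sq: "(norm (gradL_bar c S))\<^sup>2 = gradL_bar c S \<bullet> it_g S"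
proof -
  have "gradL_bar c S \<bullet> (transpose G *v lam_bar c S) = 0"
    using inner_transpose_mult[of G "lam_bar c S" "gradL_bar c S"] gradL_in_kernel
    by (simp add: inner_commute)
  then have "gradL_bar c S \<bullet> gradL_bar c S = gradL_bar c S \<bullet> it_g S"
    by (subst (2) gradL_bar_def) (simp add: inner_add_right)
  then show ?thesis by (simp add: dot_square_norm)
qed

lemma norm_gradL_le: "norm (gradL_bar c S) \<le> \<kappa>\<^sub>g"
proof -
  have "norm (gradL_bar c S) * norm (gradL_bar c S) \<le> norm (gradL_bar c S) * norm (it_g S)"
    using norm_cauchy_schwarz[of "gradL_bar c S" "it_g S"] gradL_sq by (simp add: power2_eq_square)
  then have "norm (gradL_bar c S) \<le> norm (it_g S)"
    by (cases "gradL_bar c S = 0") auto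
  then show ?thesis using g_le by linarith
qed

text \<open>
  The projected gradient lies in the kernel of the Jacobian, hence is \<open>it_Z S *v y\<close> with
  \<open>norm y = norm (gradL_bar c S)\<close>. Testing the shifted gradient with it shows that the shift
  costs at most \<open>h * norm w\<close>.
\<close>

lemma gradL_le_reduced_gradient:
  "norm (gradL_bar c S) \<le> norm (transpose (it_Z S) *v shifted_grad p c S) + h * norm w"
proof -
  let ?L = "gradL_bar c S" and ?q = "transpose (it_Z S) *v shifted_grad p c S"
  have "?L \<in> range ((*v) (it_Z S))"
    using gradL_in_kernel kernel span_columns_eq_range[of "it_Z S"] by blast
  then obtain y where y: "?L = it_Z S *v y" by blast
  have "norm ?L * norm ?L = ?L \<bullet> shifted_grad p c S - ?L \<bullet> (it_H S *v w)"
    using gradL_sq by (simp add: shifted_grad_def inner_add_right power2_eq_square)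
  also have "?L \<bullet> shifted_grad p c S = ?q \<bullet> y"
    unfolding y inner_transpose_mult by (rule inner_commute)
  also have "?q \<bullet> y \<le> norm ?q * norm ?L"
    using norm_cauchy_schwarz[of ?q y] by (simp add: y norm_orthonormal_mult[OF orthonormal])
  also have "norm ?q * norm ?L - ?L \<bullet> (it_H S *v w) \<le> norm ?q * norm ?L + h * norm ?L * norm w"
    using abs_bilinear_le[of ?L "it_H S" w] by linarith
  finally have "norm ?L * norm ?L \<le> norm ?L * (norm ?q + h * norm w)"
    by (simp add: algebra_simps)
  then show ?thesis
    using h_pos by (cases "?L = 0") auto
qed

lemma tangential_model_zero: "tangential_model p c S 0 = 0"
  by (simp add: tangential_model_def)

text \<open>
  Required decrease (full radius, KKT residual), decrease of the projected gradient in the tangential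
  radius, decrease of the shifted gradient in the tangential radius: each passage costs a multiple
  of the normal decrease, by \<open>gradient_decrease_split\<close> and \<open>decrease_function_lipschitz\<close>.
\<close>

lemma gradient_model_decrease:
  assumes step: "gradient_step p c S"
  shows "tangential_model p c S (it_u S) \<le>
    - (par_\<kappa>_fcd p / 2 * grad_decrease c S)
    + normal_decrease * ((\<kappa>\<^sub>B * D + \<kappa>\<^sub>g) / sqrt \<kappa>\<^sub>1
        + \<kappa>\<^sub>c / sqrt \<kappa>\<^sub>1 * (\<kappa>\<^sub>B + \<kappa>\<^sub>2 * \<kappa>\<^sub>B) / sqrt \<kappa>\<^sub>1)"
proof -
  define q where "q = norm (transpose (it_Z S) *v shifted_grad p c S)"
  define L where "L = norm (gradL_bar c S)"
  define A where "A = norm (gradL_RS c S)"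
  define B where "B = norm (c_RS c S)"
  define N where "N = sqrt (A\<^sup>2 + B\<^sup>2)"
  define K where "K = kkt_bar c S"
  define R where "R = tangential_radius p c S"
  define \<theta> where "\<theta> = min (it_\<Delta> S) N / N"
  have LA: "L = h * A" using h_pos by (simp add: L_def A_def gradL_RS_def)
  have nonneg: "0 \<le> A" "0 \<le> B" "0 \<le> N" "0 \<le> q" "0 \<le> L" "0 \<le> R"
    using radii_nonneg by (auto simp: A_def B_def N_def q_def L_def R_def)
  have N': "norm (gradL_RS c S, c_RS c S) = N" by (simp add: norm_Pair N_def A_def B_def)
  have R: "R = it_\<Delta> S * A / N" using step by (simp add: R_def tangential_radius_def N' A_def)
  have K: "K = sqrt ((h * A)\<^sup>2 + (opnorm G * B)\<^sup>2)"
    unfolding LA [symmetric] by (simp add: K_def kkt_bar_def norm_Pair norm_c_eq B_def L_def)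
  have \<theta>B: "\<theta> * B \<le> normal_decrease / sqrt \<kappa>\<^sub>1"
    unfolding \<theta>_def B_def
    by (rule normal_decrease_ge) (use step nonneg in \<open>auto simp: normal_radius_def N'\<close>)
  have "0 \<le> \<theta>" using radius nonneg by (simp add: \<theta>_def)
  have "K * min (it_\<Delta> S) (K / h) \<le> h * A * min (it_\<Delta> S * A / N) A + \<theta> * B\<^sup>2 * (h + (opnorm G)\<^sup>2 / h)"
    unfolding \<theta>_def using nonneg h_pos radius K by (intro gradient_decrease_split) (auto simp: N_def)
  also have "h * A * min (it_\<Delta> S * A / N) A = L * min R (L / h)"
    using h_pos by (simp add: LA R)
  also have "\<theta> * B\<^sup>2 * (h + (opnorm G)\<^sup>2 / h) = (\<theta> * B) * (B * (h + (opnorm G)\<^sup>2 * (1 / h)))"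
    by (simp add: power2_eq_square)
  also have "\<dots> \<le> (normal_decrease / sqrt \<kappa>\<^sub>1) * (\<kappa>\<^sub>c / sqrt \<kappa>\<^sub>1 * (\<kappa>\<^sub>B + \<kappa>\<^sub>2 * \<kappa>\<^sub>B))"
  proof -
    have "0 \<le> \<kappa>\<^sub>2" using G_le G_pos by (meson less_le_trans less_imp_le real_sqrt_ge_0_iff)
    then have "(opnorm G)\<^sup>2 \<le> \<kappa>\<^sub>2" using power_mono[OF G_le, of 2] G_pos by simp
    then have "h + (opnorm G)\<^sup>2 * (1 / h) \<le> \<kappa>\<^sub>B + \<kappa>\<^sub>2 * \<kappa>\<^sub>B"
      using H_le inverse_h_le h_pos \<open>0 \<le> \<kappa>\<^sub>2\<close> by (intro add_mono mult_mono) auto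
    then have "B * (h + (opnorm G)\<^sup>2 * (1 / h)) \<le> \<kappa>\<^sub>c / sqrt \<kappa>\<^sub>1 * (\<kappa>\<^sub>B + \<kappa>\<^sub>2 * \<kappa>\<^sub>B)"
      using norm_c_RS_le h_pos bounds_nonneg \<kappa>\<^sub>1 by (intro mult_mono) (auto simp: B_def)
    then show ?thesis
      using \<theta>B nonneg h_pos normal_decrease_bounds \<kappa>\<^sub>1 by (rule_tac mult_mono) auto
  qed
  finally have 1: "grad_decrease c S \<le> L * min R (L / h)
      + (normal_decrease / sqrt \<kappa>\<^sub>1) * (\<kappa>\<^sub>c / sqrt \<kappa>\<^sub>1 * (\<kappa>\<^sub>B + \<kappa>\<^sub>2 * \<kappa>\<^sub>B))"
    by (simp add: grad_decrease_def K_def)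
  have "L * min R (L / h) \<le> q * min R (q / h) + h * norm w * (R + L / h)"
    using nonneg h_pos gradL_le_reduced_gradient
    by (intro decrease_function_lipschitz) (auto simp: L_def q_def)
  also have "h * norm w * (R + L / h) = norm w * (h * R + L)"
    using h_pos by (simp add: field_simps)
  also have "\<dots> \<le> normal_decrease / sqrt \<kappa>\<^sub>1 * (\<kappa>\<^sub>B * D + \<kappa>\<^sub>g)"
    using norm_normal_step_le H_le tangential_radius_le norm_gradL_le h_pos nonneg \<kappa>\<^sub>B normal_decrease_bounds \<kappa>\<^sub>1
    by (intro mult_mono add_mono) (auto simp: R_def L_def)
  finally have 2: "L * min R (L / h) \<le> q * min R (q / h) + normal_decrease / sqrt \<kappa>\<^sub>1 * (\<kappa>\<^sub>B * D + \<kappa>\<^sub>g)"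
    by simp
  have "min R (q / h) \<le> min_quot R q (opnorm (reduced_hess S))"
  proof (cases "opnorm (reduced_hess S) = 0")
    case False
    then have "q / h \<le> q / opnorm (reduced_hess S)"
      using reduced_hess_le opnorm_nonneg[of "reduced_hess S"] nonneg by (intro divide_left_mono) auto
    then show ?thesis using False by (auto simp: min_quot_def)
  qed (simp add: min_quot_def)
  then have q_le: "q * min R (q / h) \<le> q * min_quot R q (opnorm (reduced_hess S))"
    using nonneg by (intro mult_left_mono) auto
  have 3: "grad_decrease c S \<le> q * min_quot R q (opnorm (reduced_hess S))
     + normal_decrease * ((\<kappa>\<^sub>B * D + \<kappa>\<^sub>g) / sqrt \<kappa>\<^sub>1
        + \<kappa>\<^sub>c / sqrt \<kappa>\<^sub>1 * (\<kappa>\<^sub>B + \<kappa>\<^sub>2 * \<kappa>\<^sub>B) / sqrt \<kappa>\<^sub>1)" (is "_ \<le> ?m + ?E")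
  proof -
    have split: "x * (X / a + k / a * Y / a) = x / a * X + x / a * (k / a * Y)" for x X k Y a :: real
      by (simp add: distrib_left)
    have combine: "d \<le> m' + (e + e')" if "d \<le> l + e'" "l \<le> m + e" "m \<le> m'" for d l m m' e e' :: real
      using that by simp
    show ?thesis unfolding split by (rule combine[OF 1 2 q_le])
  qed
  have "0 \<le> ?E"
    using order_trans[OF _ G_le, of 0] opnorm_nonneg[of G] normal_decrease_bounds bounds_nonneg \<kappa>\<^sub>1 \<kappa>\<^sub>B
    by (intro mult_nonneg_nonneg add_nonneg_nonneg divide_nonneg_nonneg) auto
  then have "par_\<kappa>_fcd p / 2 * ?E \<le> 1 * ?E" using fcd by (intro mult_right_mono) auto
  moreover have "par_\<kappa>_fcd p / 2 * grad_decrease c S \<le> par_\<kappa>_fcd p / 2 * (?m + ?E)"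
    using 3 fcd by (intro mult_left_mono) auto
  moreover have "tangential_model p c S (it_u S) \<le> - (par_\<kappa>_fcd p / 2 * ?m)"
    using tangential step
    by (simp add: valid_tangential_def Let_def tangential_model_zero q_def R_def mult.assoc)
  ultimately show ?thesis unfolding distrib_left[of "par_\<kappa>_fcd p / 2"] by linarith
qed

text \<open>
  The curvature along the computed step is at least \<open>- h\<close> and at most \<open>- par_\<kappa>_fcd p * \<tau>\<close> relative to
  the squared radius. The bound on the negative curvature measure thus comes from the existence of
  an eigen step.
\<close>

lemma tau_RS_le:
  assumes step: "\<not> gradient_step p c S"
  shows "0 < tau_RS p S" "tau_RS p S \<le> 1 / par_\<kappa>_fcd p"
proof -
  define R where "R = tangential_radius p c S"
  have "0 \<le> grad_decrease c S"
    using radius h_pos by (auto simp: grad_decrease_def kkt_bar_def)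
  then have "\<tau> \<noteq> 0" using step by (auto simp: gradient_step_def eigen_decrease_def)
  then have "0 < \<tau>" using tau_nonneg by simp
  then show pos: "0 < tau_RS p S" using h_pos by (simp add: tau_RS_def)
  have "0 < R"
    using step pos radius by (auto simp: R_def tangential_radius_def norm_Pair intro!: divide_pos_pos add_nonneg_pos)
  have "(norm t)\<^sup>2 \<le> R\<^sup>2"
    using norm_tangential_step by (intro power_mono) (auto simp: R_def)
  then have "h * (norm t)\<^sup>2 \<le> h * R\<^sup>2" using h_pos by (intro mult_left_mono) auto
  moreover have "- (h * (norm t)\<^sup>2) \<le> t \<bullet> (it_H S *v t)"
    using abs_bilinear_le[of t "it_H S" t] by (simp add: power2_eq_square mult_ac abs_le_iff)
  moreover have "t \<bullet> (it_H S *v t) \<le> - (par_\<kappa>_fcd p * \<tau> * R\<^sup>2)"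
    using tangential step by (simp add: valid_tangential_def R_def)
  ultimately have "par_\<kappa>_fcd p * \<tau> * R\<^sup>2 \<le> h * R\<^sup>2" by linarith
  then have "par_\<kappa>_fcd p * \<tau> \<le> h" using \<open>0 < R\<close> by simp
  then show "tau_RS p S \<le> 1 / par_\<kappa>_fcd p"
    using h_pos fcd by (simp add: tau_RS_def field_simps)
qed

lemma eigen_model_decrease:
  assumes step: "\<not> gradient_step p c S"
  shows "tangential_model p c S (it_u S) \<le>
    - (par_\<kappa>_fcd p / 2 * eigen_decrease p c S)
    + normal_decrease * (\<kappa>\<^sub>B * ((D + (1 / par_\<kappa>_fcd p + \<kappa>\<^sub>c / sqrt \<kappa>\<^sub>1)) * (D + 1 / par_\<kappa>_fcd p * sqrt \<kappa>\<^sub>2)) / sqrt \<kappa>\<^sub>1)"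
proof -
  define A where "A = tau_RS p S"
  define B where "B = norm (c_RS c S)"
  define N where "N = sqrt (A\<^sup>2 + B\<^sup>2)"
  define R where "R = tangential_radius p c S"
  define \<theta> where "\<theta> = min (it_\<Delta> S) N / N"
  note A = tau_RS_le[OF step, folded A_def]
  have \<tau>A: "\<tau> = h * A" using h_pos by (simp add: A_def tau_RS_def)
  have nonneg: "0 \<le> A" "0 \<le> B" "0 < N"
    using A by (auto simp: B_def N_def intro: add_pos_nonneg)
  have N': "norm (c_RS c S, tau_RS p S) = N"
    by (simp add: norm_Pair N_def A_def B_def add.commute)
  have R: "R = it_\<Delta> S * A / N" using step by (simp add: R_def tangential_radius_def N' A_def)
  have \<theta>B: "\<theta> * B \<le> normal_decrease / sqrt \<kappa>\<^sub>1"
    unfolding \<theta>_def B_def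
    by (rule normal_decrease_ge) (use step nonneg in \<open>auto simp: normal_radius_def N'\<close>)
  have "0 \<le> \<theta>" using radius nonneg by (simp add: \<theta>_def)
  have NAB: "N \<le> A + B" unfolding N_def using nonneg by (intro sqrt_sum_squares_le_sum) auto
  have "eigen_decrease p c S = h * (A * (it_\<Delta> S * (it_\<Delta> S + opnorm G * B)))"
    by (simp add: eigen_decrease_def \<tau>A norm_c_eq B_def)
  also have "\<dots> \<le> h * (A * R\<^sup>2 + \<theta> * B * ((it_\<Delta> S + N) * (it_\<Delta> S + A * opnorm G)))"
    unfolding R \<theta>_def using nonneg h_pos radius G_pos
    by (intro mult_left_mono eigen_decrease_split) (auto simp: N_def)
  also have "\<dots> = \<tau> * R\<^sup>2 + h * (\<theta> * B * ((it_\<Delta> S + N) * (it_\<Delta> S + A * opnorm G)))"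
    by (simp add: \<tau>A algebra_simps)
  also have "h * (\<theta> * B * ((it_\<Delta> S + N) * (it_\<Delta> S + A * opnorm G))) \<le>
      \<kappa>\<^sub>B * (normal_decrease / sqrt \<kappa>\<^sub>1 * ((D + (1 / par_\<kappa>_fcd p + \<kappa>\<^sub>c / sqrt \<kappa>\<^sub>1)) * (D + 1 / par_\<kappa>_fcd p * sqrt \<kappa>\<^sub>2)))"
    (is "_ \<le> ?E")
  proof -
    have "it_\<Delta> S + N \<le> D + (1 / par_\<kappa>_fcd p + \<kappa>\<^sub>c / sqrt \<kappa>\<^sub>1)"
      using radius NAB A norm_c_RS_le by (simp add: B_def)
    moreover have "it_\<Delta> S + A * opnorm G \<le> D + 1 / par_\<kappa>_fcd p * sqrt \<kappa>\<^sub>2"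
      using radius A G_le G_pos fcd by (intro add_mono mult_mono) auto
    ultimately show ?thesis
      using H_le h_pos \<theta>B \<open>0 \<le> \<theta>\<close> nonneg radius G_pos \<kappa>\<^sub>B normal_decrease_bounds \<kappa>\<^sub>1
      by (intro mult_mono) (auto intro!: mult_nonneg_nonneg add_nonneg_nonneg)
  qed
  finally have 1: "eigen_decrease p c S \<le> \<tau> * R\<^sup>2 + ?E" by simp
  have "0 \<le> ?E"
    using order_trans[OF _ G_le, of 0] opnorm_nonneg[of G] normal_decrease_bounds bounds_nonneg \<kappa>\<^sub>1 \<kappa>\<^sub>B fcd
    by (intro mult_nonneg_nonneg add_nonneg_nonneg divide_nonneg_nonneg) auto
  then have "par_\<kappa>_fcd p / 2 * ?E \<le> 1 * ?E" using fcd by (intro mult_right_mono) auto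
  moreover have "par_\<kappa>_fcd p / 2 * eigen_decrease p c S \<le> par_\<kappa>_fcd p / 2 * (\<tau> * R\<^sup>2 + ?E)"
    using 1 fcd by (intro mult_left_mono) auto
  moreover have "tangential_model p c S (it_u S) \<le> - (par_\<kappa>_fcd p / 2 * (\<tau> * R\<^sup>2))"
    using tangential step by (simp add: valid_tangential_def tangential_model_def R_def mult.assoc)
  moreover have "?E = normal_decrease * (\<kappa>\<^sub>B * ((D + (1 / par_\<kappa>_fcd p + \<kappa>\<^sub>c / sqrt \<kappa>\<^sub>1)) * (D + 1 / par_\<kappa>_fcd p * sqrt \<kappa>\<^sub>2)) / sqrt \<kappa>\<^sub>1)"
    by (simp only: times_divide_eq_right times_divide_eq_left mult_ac)
  ultimately show ?thesis unfolding distrib_left[of "par_\<kappa>_fcd p / 2"] by linarith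
qed

end

text \<open>
  The first summand is the price of the normal step in the quadratic model (\<open>Pred_le\<close>), the maximum is
  the gap between required and achieved tangential decrease for the two kinds of step.
\<close>

definition merit_threshold :: "real \<Rightarrow> real \<Rightarrow> real \<Rightarrow> real \<Rightarrow> real \<Rightarrow> real \<Rightarrow> real \<Rightarrow> real" where
  "merit_threshold \<kappa>\<^sub>1 \<kappa>\<^sub>2 \<kappa>\<^sub>c \<kappa>\<^sub>g \<kappa>\<^sub>B D \<kappa> =
     (\<kappa>\<^sub>g + \<kappa>\<^sub>B * (\<kappa>\<^sub>c / sqrt \<kappa>\<^sub>1) + \<kappa>\<^sub>B * D) / sqrt \<kappa>\<^sub>1
     + max ((\<kappa>\<^sub>B * D + \<kappa>\<^sub>g) / sqrt \<kappa>\<^sub>1 + \<kappa>\<^sub>c / sqrt \<kappa>\<^sub>1 * (\<kappa>\<^sub>B + \<kappa>\<^sub>2 * \<kappa>\<^sub>B) / sqrt \<kappa>\<^sub>1)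
           (\<kappa>\<^sub>B * ((D + (1 / \<kappa> + \<kappa>\<^sub>c / sqrt \<kappa>\<^sub>1)) * (D + 1 / \<kappa> * sqrt \<kappa>\<^sub>2)) / sqrt \<kappa>\<^sub>1)"

lemma (in bounded_iteration) Pred_sufficient:
  assumes "merit_threshold \<kappa>\<^sub>1 \<kappa>\<^sub>2 \<kappa>\<^sub>c \<kappa>\<^sub>g \<kappa>\<^sub>B D (par_\<kappa>_fcd p) \<le> \<mu>"
  shows "Pred_at p c S \<mu> \<le> - (par_\<kappa>_fcd p / 2 * max (grad_decrease c S) (eigen_decrease p c S))"
proof -
  define E where "E = (if gradient_step p c S then
        (\<kappa>\<^sub>B * D + \<kappa>\<^sub>g) / sqrt \<kappa>\<^sub>1 + \<kappa>\<^sub>c / sqrt \<kappa>\<^sub>1 * (\<kappa>\<^sub>B + \<kappa>\<^sub>2 * \<kappa>\<^sub>B) / sqrt \<kappa>\<^sub>1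
      else \<kappa>\<^sub>B * ((D + (1 / par_\<kappa>_fcd p + \<kappa>\<^sub>c / sqrt \<kappa>\<^sub>1)) * (D + 1 / par_\<kappa>_fcd p * sqrt \<kappa>\<^sub>2)) / sqrt \<kappa>\<^sub>1)"
  have model: "tangential_model p c S (it_u S) \<le>
      - (par_\<kappa>_fcd p / 2 * max (grad_decrease c S) (eigen_decrease p c S)) + normal_decrease * E"
  proof (cases "gradient_step p c S")
    case True
    then show ?thesis using gradient_model_decrease by (simp add: E_def gradient_step_def max_absorb1)
  next
    case False
    then show ?thesis using eigen_model_decrease by (simp add: E_def gradient_step_def max_absorb2)
  qed
  have "(\<kappa>\<^sub>g + \<kappa>\<^sub>B * (\<kappa>\<^sub>c / sqrt \<kappa>\<^sub>1) + \<kappa>\<^sub>B * D) / sqrt \<kappa>\<^sub>1 + E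
      \<le> merit_threshold \<kappa>\<^sub>1 \<kappa>\<^sub>2 \<kappa>\<^sub>c \<kappa>\<^sub>g \<kappa>\<^sub>B D (par_\<kappa>_fcd p)"
    unfolding merit_threshold_def E_def by (rule add_left_mono) auto
  then have "normal_decrease * (((\<kappa>\<^sub>g + \<kappa>\<^sub>B * (\<kappa>\<^sub>c / sqrt \<kappa>\<^sub>1) + \<kappa>\<^sub>B * D) / sqrt \<kappa>\<^sub>1 - \<mu>) + E) \<le> 0"
    using assms normal_decrease_bounds by (intro mult_nonneg_nonpos) auto
  then show ?thesis
    using Pred_le[of \<mu>] model unfolding distrib_left by linarith
qed


section \<open>Stabilization of the merit parameter\<close>

text \<open>If the least exponent is positive, the previous power was still rejected and therefore below the
  threshold, so the accepted value overshoots \<open>T\<close> by at most one factor.\<close>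

lemma least_power_le:
  fixes \<rho> \<mu> T :: real
  assumes "\<And>x. T \<le> x \<Longrightarrow> P x" and "1 < \<rho>" and "0 < \<mu>"
  shows "\<rho> ^ (LEAST j. P (\<rho> ^ j * \<mu>)) * \<mu> \<le> max \<mu> (\<rho> * T)"
proof (cases "LEAST j. P (\<rho> ^ j * \<mu>)")
  case (Suc j)
  then have "\<not> P (\<rho> ^ j * \<mu>)"
    using not_less_Least[of j "\<lambda>j. P (\<rho> ^ j * \<mu>)"] by simp
  then have "\<rho> ^ j * \<mu> < T" using assms(1) not_le by blast
  then have "\<rho> * (\<rho> ^ j * \<mu>) \<le> \<rho> * T" using assms by simp
  then show ?thesis unfolding Suc by (simp add: mult.assoc)
qed simp

lemma bounded_mono_nat_stabilizes:
  fixes n :: "nat \<Rightarrow> nat"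
  assumes "mono n" and "\<And>k. n k \<le> b"
  shows "\<exists>K. \<forall>k\<ge>K. n k = n K"
proof -
  have fin: "finite (range n)"
    by (rule finite_subset[of _ "{..b}"]) (use assms(2) in auto)
  have "Max (range n) \<in> range n" using fin by (rule Max_in) simp
  then obtain K where K: "Max (range n) = n K" by blast
  have "n k = n K" if "K \<le> k" for k
  proof (rule antisym)
    show "n k \<le> n K" unfolding K [symmetric] by (rule Max_ge[OF fin]) simp
    show "n K \<le> n k" using assms(1) that by (rule monoD)
  qed
  then show ?thesis by blast
qed

text \<open>Bounded exponents of \<open>\<rho>\<close> are bounded natural numbers, and these can increase only finitely often.\<close>

lemma geometric_steps_stabilize:
  fixes \<mu> :: "nat \<Rightarrow> real"
  assumes \<rho>: "1 < \<rho>" and pos: "0 < \<mu> 0"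
    and step: "\<And>k. \<exists>j. \<mu> (Suc k) = \<rho> ^ j * \<mu> k" and bd: "\<And>k. \<mu> k \<le> b"
  shows "\<exists>K. \<forall>k\<ge>K. \<mu> k = \<mu> K"
proof -
  obtain j where j: "\<And>k. \<mu> (Suc k) = \<rho> ^ j k * \<mu> k" using step by metis
  define n where "n k = (\<Sum>i<k. j i)" for k
  have \<mu>: "\<mu> k = \<rho> ^ n k * \<mu> 0" for k
    by (induction k) (simp_all add: n_def j power_add)
  have "mono n" unfolding n_def by (intro monoI sum_mono2) auto
  moreover obtain N where "b / \<mu> 0 < \<rho> ^ N" using real_arch_pow[OF \<rho>] by blast
  then have N: "b < \<rho> ^ N * \<mu> 0" using pos by (simp add: field_simps)
  have "n k \<le> N" for k
  proof (rule ccontr)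
    assume "\<not> n k \<le> N"
    then have "\<rho> ^ N * \<mu> 0 \<le> \<rho> ^ n k * \<mu> 0"
      using \<rho> pos by (intro mult_right_mono power_increasing) auto
    then show False using N bd[of k] \<mu>[of k] by simp
  qed
  ultimately obtain K where "\<forall>k\<ge>K. n k = n K"
    using bounded_mono_nat_stabilizes by blast
  then show ?thesis by (metis \<mu>)
qed

lemma measurable_stabilization_time:
  fixes Y :: "nat \<Rightarrow> 'w \<Rightarrow> real"
  assumes "\<And>k. Y k \<in> borel_measurable M"
    and "\<And>\<omega>. \<omega> \<in> space M \<Longrightarrow> \<exists>K. \<forall>k\<ge>K. Y k \<omega> = Y K \<omega>"
  shows "\<exists>K \<in> measurable M (count_space UNIV). \<forall>\<omega>\<in>space M. \<forall>k\<ge>K \<omega>. Y k \<omega> = Y (K \<omega>) \<omega>"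
proof
  let ?K = "\<lambda>\<omega>. LEAST n. \<forall>k\<ge>n. Y k \<omega> = Y n \<omega>"
  show "?K \<in> measurable M (count_space UNIV)"
  proof (rule measurable_Least)
    fix n
    have "Measurable.pred M (\<lambda>\<omega>. Y k \<omega> = Y n \<omega>)" for k
      unfolding pred_def by (rule borel_measurable_eq) (rule assms)+
    then have "Measurable.pred M (\<lambda>\<omega>. \<forall>k\<in>{n..}. Y k \<omega> = Y n \<omega>)"
      by (intro pred_intros_countable_bounded) auto
    then show "Measurable.pred M (\<lambda>\<omega>. \<forall>k\<ge>n. Y k \<omega> = Y n \<omega>)" unfolding Ball_def atLeast_iff .
  qed
  show "\<forall>\<omega>\<in>space M. \<forall>k\<ge>?K \<omega>. Y k \<omega> = Y (?K \<omega>) \<omega>"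
  proof
    fix \<omega> assume "\<omega> \<in> space M"
    from LeastI_ex[OF assms(2)[OF this]] show "\<forall>k\<ge>?K \<omega>. Y k \<omega> = Y (?K \<omega>) \<omega>" .
  qed
qed

lemma trust_radius_bounds:
  assumes "valid_parameters p" and "it_\<Delta> (S 0) \<in> {0<..<par_\<Delta>_max p}"
    and "\<And>k. valid_transition p c (S k) (S (Suc k))"
  shows "0 < it_\<Delta> (S k) \<and> it_\<Delta> (S k) \<le> par_\<Delta>_max p"
proof (induction k)
  case 0
  then show ?case using assms(2) by simp
next
  case (Suc k)
  have \<gamma>: "1 < par_\<gamma> p" using assms(1) by (simp add: valid_parameters_def)
  then have "it_\<Delta> (S k) / par_\<gamma> p \<le> it_\<Delta> (S k)" "0 < it_\<Delta> (S k) / par_\<gamma> p"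
    using Suc by (auto simp: field_simps)
  then show ?case
    using assms(3)[of k] Suc \<gamma> by (auto simp: valid_transition_def)
qed

lemma mu_updated_factor: "\<exists>j. mu_updated p c S = par_\<rho> p ^ j * it_\<mu> S"
proof (cases "computes_step p c S")
  case True
  then show ?thesis unfolding mu_updated_def if_P[OF True] by blast
next
  case False
  then show ?thesis by (intro exI[of _ 0]) (simp add: mu_updated_def)
qed

theorem lemma4p19:
  fixes X :: "'s measure"
    and F :: "real^'d \<Rightarrow> 's \<Rightarrow> real"
    and f :: "real^'d \<Rightarrow> real"
    and c :: "real^'d \<Rightarrow> real^'m"
    and p :: parameters
    and x\<^sub>0 :: "real^'d"
    and \<Delta>\<^sub>0 \<epsilon>\<^sub>0 \<mu>\<^sub>0 :: real
    and M :: "'w measure"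
    and Fpre Fmid :: "nat \<Rightarrow> 'w measure"
    and run :: "nat \<Rightarrow> 'w \<Rightarrow> ('d::finite, 'p::finite) iteration"
  assumes dims: "CARD('d) = CARD('m) + CARD('p)"
    and objective: "expected_objective X F f"
    and algorithm: "TR_SQP_STORM p f c x\<^sub>0 \<Delta>\<^sub>0 \<epsilon>\<^sub>0 \<mu>\<^sub>0 M Fpre Fmid run"
    and regular: "regularity p f c M run"
    and grad_error: "\<exists>B>0. \<forall>\<omega>\<in>space M. \<forall>k. norm (it_g (run k \<omega>) - grad f (it_x (run k \<omega>))) \<le> B"
    and hess_bounds: "\<exists>\<kappa>_B>0. \<forall>\<omega>\<in>space M. \<forall>k.
          1 / \<kappa>_B \<le> opnorm (it_H (run k \<omega>)) \<and> opnorm (it_H (run k \<omega>)) \<le> \<kappa>_B"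
  shows "\<exists>K \<in> measurable M (count_space (UNIV :: nat set)). \<exists>\<mu>_hat :: real.
          \<forall>\<omega>\<in>space M. \<forall>k\<ge>K \<omega>.
            mu_updated p c (run k \<omega>) = mu_updated p c (run (K \<omega>) \<omega>) \<and>
            mu_updated p c (run (K \<omega>) \<omega>) \<le> \<mu>_hat"
proof -
  have params: "valid_parameters p" and \<Delta>0: "\<Delta>\<^sub>0 \<in> {0<..<par_\<Delta>_max p}" and \<mu>0: "0 < \<mu>\<^sub>0"
    and adapted: "adapted_run M Fpre Fmid run"
    and init: "\<And>\<omega>. \<omega> \<in> space M \<Longrightarrow> it_\<Delta> (run 0 \<omega>) = \<Delta>\<^sub>0 \<and> it_\<mu> (run 0 \<omega>) = \<mu>\<^sub>0"
    and valid: "\<And>\<omega> k. \<omega> \<in> space M \<Longrightarrow> valid_iteration p c (run k \<omega>)"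
    and transition: "\<And>\<omega> k. \<omega> \<in> space M \<Longrightarrow> valid_transition p c (run k \<omega>) (run (Suc k) \<omega>)"
    using algorithm by (auto simp: TR_SQP_STORM_def)
  have "\<exists>\<kappa>_c>0. \<exists>\<kappa>_grad>0. \<exists>\<kappa>_1G>0. \<exists>\<kappa>_2G>0. \<forall>\<omega>\<in>space M. \<forall>k.
        (let x = it_x (run k \<omega>); G = Jac c x in
           norm (c x) \<le> \<kappa>_c \<and> norm (grad f x) \<le> \<kappa>_grad \<and>
           loewner_le (mat \<kappa>_1G) (G ** transpose G) \<and>
           loewner_le (G ** transpose G) (mat \<kappa>_2G))"
    using regular unfolding regularity_def by (elim conjE)
  then obtain \<kappa>\<^sub>c \<kappa>\<^sub>d \<kappa>\<^sub>1 \<kappa>\<^sub>2 where \<kappa>\<^sub>1: "0 < \<kappa>\<^sub>1"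
    and all: "\<forall>\<omega>\<in>space M. \<forall>k.
        (let x = it_x (run k \<omega>); G = Jac c x in
           norm (c x) \<le> \<kappa>\<^sub>c \<and> norm (grad f x) \<le> \<kappa>\<^sub>d \<and>
           loewner_le (mat \<kappa>\<^sub>1) (G ** transpose G) \<and>
           loewner_le (G ** transpose G) (mat \<kappa>\<^sub>2))"
    by (elim exE conjE)
  have bounds: "norm (c (it_x (run k \<omega>))) \<le> \<kappa>\<^sub>c \<and> norm (grad f (it_x (run k \<omega>))) \<le> \<kappa>\<^sub>d \<and>
      loewner_le (mat \<kappa>\<^sub>1) (Jac c (it_x (run k \<omega>)) ** transpose (Jac c (it_x (run k \<omega>)))) \<and>
      loewner_le (Jac c (it_x (run k \<omega>)) ** transpose (Jac c (it_x (run k \<omega>)))) (mat \<kappa>\<^sub>2)"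
    if "\<omega> \<in> space M" for \<omega> k
    using bspec[OF all that] unfolding Let_def by (rule spec)
  obtain B where B: "\<And>\<omega> k. \<omega> \<in> space M \<Longrightarrow> norm (it_g (run k \<omega>) - grad f (it_x (run k \<omega>))) \<le> B"
    using grad_error by blast
  obtain \<kappa>\<^sub>B where \<kappa>\<^sub>B: "0 < \<kappa>\<^sub>B" and H: "\<And>\<omega> k. \<omega> \<in> space M \<Longrightarrow>
      1 / \<kappa>\<^sub>B \<le> opnorm (it_H (run k \<omega>)) \<and> opnorm (it_H (run k \<omega>)) \<le> \<kappa>\<^sub>B"
    using hess_bounds by blast
  have fcd: "0 < par_\<kappa>_fcd p" "par_\<kappa>_fcd p \<le> 1" and \<rho>: "1 < par_\<rho> p"
    using params by (auto simp: valid_parameters_def)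
  define T where "T = merit_threshold \<kappa>\<^sub>1 \<kappa>\<^sub>2 \<kappa>\<^sub>c (\<kappa>\<^sub>d + B) \<kappa>\<^sub>B (par_\<Delta>_max p) (par_\<kappa>_fcd p)"
  define \<mu>_hat where "\<mu>_hat = max \<mu>\<^sub>0 (par_\<rho> p * T)"
  have sufficient: "Pred_at p c (run k \<omega>) \<mu> \<le>
      - (par_\<kappa>_fcd p / 2 * max (grad_decrease c (run k \<omega>)) (eigen_decrease p c (run k \<omega>)))"
    if \<omega>: "\<omega> \<in> space M" and step: "computes_step p c (run k \<omega>)" and \<mu>: "T \<le> \<mu>" for \<omega> k \<mu>
  proof -
    have "norm (it_g (run k \<omega>)) \<le> \<kappa>\<^sub>d + B"
      using bounds[OF \<omega>, of k] B[OF \<omega>, of k] norm_triangle_sub[of "it_g (run k \<omega>)" "grad f (it_x (run k \<omega>))"]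
      by linarith
    moreover have "0 < it_\<Delta> (run k \<omega>) \<and> it_\<Delta> (run k \<omega>) \<le> par_\<Delta>_max p"
      by (rule trust_radius_bounds[where c = c]) (use params \<Delta>0 init[OF \<omega>] transition[OF \<omega>] in auto)
    moreover have "transpose (it_Z (run k \<omega>)) ** it_Z (run k \<omega>) = mat 1"
        "span (columns (it_Z (run k \<omega>))) = {y. Jac c (it_x (run k \<omega>)) *v y = 0}"
        "valid_tangential p c (run k \<omega>)"
      using valid[OF \<omega>, of k] step unfolding valid_iteration_def by (elim conjE, blast)+
    ultimately interpret bounded_iteration p c "run k \<omega>" \<kappa>\<^sub>1 \<kappa>\<^sub>2 \<kappa>\<^sub>c "\<kappa>\<^sub>d + B" \<kappa>\<^sub>B "par_\<Delta>_max p"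
      using bounds[OF \<omega>, of k] H[OF \<omega>, of k] fcd \<kappa>\<^sub>1 \<kappa>\<^sub>B by unfold_locales (elim conjE, assumption)+
    show ?thesis using Pred_sufficient \<mu> by (simp add: T_def)
  qed
  have mu_eq: "it_\<mu> (run (Suc k) \<omega>) = mu_updated p c (run k \<omega>)" if "\<omega> \<in> space M" for k \<omega>
    using transition[OF that] by (simp add: valid_transition_def)
  \<comment> \<open>The initial value may already exceed the threshold; then it is kept, hence the maximum in \<open>\<mu>_hat\<close>.\<close>
  have mu_bounds: "0 < it_\<mu> (run k \<omega>) \<and> it_\<mu> (run k \<omega>) \<le> \<mu>_hat" if \<omega>: "\<omega> \<in> space M" for k \<omega>
  proof (induction k)
    case 0
    then show ?case using init[OF \<omega>] \<mu>0 by (simp add: \<mu>_hat_def)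
  next
    case (Suc k)
    obtain j where "mu_updated p c (run k \<omega>) = par_\<rho> p ^ j * it_\<mu> (run k \<omega>)"
      using mu_updated_factor by blast
    then have "0 < mu_updated p c (run k \<omega>)" using Suc \<rho> by simp
    moreover have "mu_updated p c (run k \<omega>) \<le> \<mu>_hat"
    proof (cases "computes_step p c (run k \<omega>)")
      case True
      have "mu_updated p c (run k \<omega>) \<le> max (it_\<mu> (run k \<omega>)) (par_\<rho> p * T)"
        unfolding mu_updated_def if_P[OF True]
        by (rule least_power_le) (use sufficient[OF \<omega> True] \<rho> Suc in auto)
      then show ?thesis using Suc by (auto simp: \<mu>_hat_def)
    next
      case False
      then show ?thesis using Suc by (simp add: mu_updated_def)
    qed
    ultimately show ?case by (simp add: mu_eq[OF \<omega>])
  qed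
  \<comment> \<open>The updated value is read off the next iterate, where the adaptedness of the run makes it measurable.\<close>
  have "\<exists>K \<in> measurable M (count_space UNIV). \<forall>\<omega>\<in>space M. \<forall>k\<ge>K \<omega>.
      it_\<mu> (run (Suc k) \<omega>) = it_\<mu> (run (Suc (K \<omega>)) \<omega>)"
  proof (rule measurable_stabilization_time[where Y = "\<lambda>k \<omega>. it_\<mu> (run (Suc k) \<omega>)"])
    show "(\<lambda>\<omega>. it_\<mu> (run (Suc k) \<omega>)) \<in> borel_measurable M" for k
      using adapted unfolding adapted_run_def by (blast intro: measurable_from_subalg)
    show "\<exists>K. \<forall>k\<ge>K. it_\<mu> (run (Suc k) \<omega>) = it_\<mu> (run (Suc K) \<omega>)" if \<omega>: "\<omega> \<in> space M" for \<omega>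
    proof (rule geometric_steps_stabilize[where \<rho> = "par_\<rho> p" and b = \<mu>_hat])
      show "\<exists>j. it_\<mu> (run (Suc (Suc k)) \<omega>) = par_\<rho> p ^ j * it_\<mu> (run (Suc k) \<omega>)" for k
        using mu_updated_factor[of p c "run (Suc k) \<omega>"] mu_eq[OF \<omega>, of "Suc k"] by simp
    qed (use \<rho> mu_bounds[OF \<omega>] in blast)+
  qed
  then obtain K where "K \<in> measurable M (count_space UNIV)"
    and "\<forall>\<omega>\<in>space M. \<forall>k\<ge>K \<omega>. it_\<mu> (run (Suc k) \<omega>) = it_\<mu> (run (Suc (K \<omega>)) \<omega>)"
    by blast
  then show ?thesis
    using mu_eq mu_bounds by (intro bexI[of _ K] exI[of _ \<mu>_hat]) (metis, assumption)
qed

end
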